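(* For every $r\in\mathbb Z$ the interior of the three-dimensional phase-lock area $$L_r=\{(B,A;\omega)\in\mathbb R^2_{B,A}\times(\mathbb R_+)_\omega : \rho(B,A;\omega)=r\}$$ has infinitely many connected components.
   Context: $\mathbb R_+=(0,+\infty)$. For $\omega>0$, $B,A\in\mathbb R$ consider the equation $\frac{d\phi}{dt}=-\sin\phi+B+A\cos\omega t$ (model of overdamped Josephson junction). Setting $\tau=\omega t$, $\theta=\phi+\frac\pi2$, $\ell=\frac B\omega$, $a=\frac1\omega$, $s=\frac A\omega$ transforms it to $\frac{d\theta}{d\tau}=a\cos\theta+\ell+s\cos\tau$ on the torus $\mathbb R^2_{\theta,\tau}/2\pi\mathbb Z^2$. The rotation number is $\rho(B,A;\omega)=\lim_{k\to+\infty}\frac{\theta(2\pi k)}{2\pi k}$, where $\theta(\tau)$ is any $\mathbb R$-valued solution of the latter equation (the limit does not depend on the solution). A three-dimensional phase-lock area is a level set $L_r$ of $\rho$ with non-empty interior; it is known that these exist exactly for $r\in\mathbb Z$. *)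

theory Defs
  imports "HOL-Analysis.Analysis"
begin

definition torus_solution :: "real \<Rightarrow> real \<Rightarrow> real \<Rightarrow> (real \<Rightarrow> real) \<Rightarrow> bool" where
  "torus_solution a l s \<theta> \<longleftrightarrow>
     (\<forall>\<tau>. (\<theta> has_real_derivative (a * cos (\<theta> \<tau>) + l + s * cos \<tau>)) (at \<tau>))"

text \<open>
  With \<open>\<tau> = \<omega> * t\<close> and \<open>\<theta> = \<phi> + pi / 2\<close>, the Josephson junction equation
  \<open>d\<phi> / dt = - sin \<phi> + B + A * cos (\<omega> * t)\<close> becomes the equation below with
  \<open>a = 1 / \<omega>\<close>, \<open>l = B / \<omega>\<close>, \<open>s = A / \<omega>\<close>.
\<close>

definition josephson_solution :: "real \<Rightarrow> real \<Rightarrow> real \<Rightarrow> (real \<Rightarrow> real) \<Rightarrow> bool" where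
  "josephson_solution B A \<omega> \<theta> \<longleftrightarrow> torus_solution (1 / \<omega>) (B / \<omega>) (A / \<omega>) \<theta>"

text \<open>
  For every \<open>\<omega> > 0\<close> global solutions exist and all of them give the same limit, so the
  description determines the value uniquely; it is only meant for \<open>\<omega> > 0\<close>.
\<close>

definition rotation_number :: "real \<Rightarrow> real \<Rightarrow> real \<Rightarrow> real" where
  "rotation_number B A \<omega> =
     (THE \<rho>. \<forall>\<theta>. josephson_solution B A \<omega> \<theta> \<longrightarrow>
        (\<lambda>k::nat. \<theta> (2 * pi * real k) / (2 * pi * real k)) \<longlonglongrightarrow> \<rho>)"

text \<open>
  The parameter space, all \<open>(B, A, \<omega>)\<close> with \<open>\<omega> > 0\<close>, is open in \<open>\<real> \<times> \<real> \<times> \<real>\<close>, so the interior of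
  a subset does not depend on which of the two it is taken in.
\<close>

definition phase_lock_area :: "real \<Rightarrow> (real \<times> real \<times> real) set" where
  "phase_lock_area r = {(B, A, \<omega>). \<omega> > 0 \<and> rotation_number B A \<omega> = r}"

end

theory Submission
  imports Defs
begin

text \<open>
  Let \<open>Q\<close> be the time \<open>2 * pi\<close> map of the flow, minus \<open>2 * pi * r\<close>. It is a Moebius map of the circle, and it is
  reversed by \<open>\<theta> \<mapsto> - \<theta>\<close>, so its fixed points come in pairs \<open>p\<close>, \<open>- p\<close>. Hence, when the rotation number is \<open>r\<close>, it cannot move
  \<open>0\<close> and \<open>pi\<close> strictly to the same side. Since \<open>Q\<close> increases with \<open>B\<close>, the interior of the phase-lock area is the disjoint union of two
  open zones: one where \<open>0\<close> moves up and \<open>pi\<close> moves down, and one where they move the other way. By the same monotonicity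
  the projections of the two zones to the half-plane of the parameters \<open>(s, a)\<close>, \<open>a > 0\<close>, are disjoint.

  For \<open>l = r\<close> and \<open>a \<longlongrightarrow> 0\<close> averaging shows that the zone is selected by the sign of a Bessel function of \<open>s\<close>, which oscillates. If there
  were only finitely many components, then one component of the first zone and one component of the second would each reach
  the boundary line \<open>a = 0\<close> at arbitrarily large \<open>s\<close>, hence at interlaced points \<open>s1 < s2 < s3 < s4\<close>. The arcs joining
  \<open>s1\<close> to \<open>s3\<close> and \<open>s2\<close> to \<open>s4\<close> in the half-plane would cross, which is impossible for arcs in disjoint sets.
\<close>

section \<open>Lipschitz differential equations on the line\<close>

text \<open>The right-hand side is the integral of the bound on \<open>g\<close> between
  \<open>0\<close> and \<open>t\<close>. So integration gains a factor \<open>1 / K\<close> in the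
  norm weighted by \<open>exp (- K * \<bar>t\<bar>)\<close>. Negative times are reflected to
  positive ones.\<close>

lemma abs_le_exp_growth:
  fixes G g :: "real \<Rightarrow> real"
  assumes G: "\<And>t. (G has_real_derivative g t) (at t)" and G0: "G 0 = 0"
    and g: "\<And>t. \<bar>g t\<bar> \<le> C * exp (K * \<bar>t\<bar>)" and K: "K > 0"
  shows "\<bar>G t\<bar> \<le> C / K * (exp (K * \<bar>t\<bar>) - 1)"
proof -
  have pos: "H t \<le> C / K * (exp (K * t) - 1)"
    if H: "\<And>t. (H has_real_derivative h t) (at t)" and "H 0 = 0"
      and h: "\<And>t. t \<ge> 0 \<Longrightarrow> h t \<le> C * exp (K * t)" and "t \<ge> 0" for H h :: "real \<Rightarrow> real" and t
  proof -
    have "(\<lambda>t. C / K * exp (K * t) - H t) 0 \<le> (\<lambda>t. C / K * exp (K * t) - H t) t"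
    proof (rule DERIV_nonneg_imp_nondecreasing[OF \<open>t \<ge> 0\<close>])
      fix u :: real assume "0 \<le> u"
      have "((\<lambda>t. C / K * exp (K * t) - H t) has_real_derivative C * exp (K * u) - h u) (at u)"
        using K by (auto intro!: derivative_eq_intros H)
      with h[OF \<open>0 \<le> u\<close>]
      show "\<exists>y. ((\<lambda>t. C / K * exp (K * t) - H t) has_real_derivative y) (at u) \<and> 0 \<le> y"
        by (metis diff_ge_0_iff_ge)
    qed
    with \<open>H 0 = 0\<close> show ?thesis by (simp add: algebra_simps)
  qed
  have G': "((\<lambda>t. G (- t)) has_real_derivative - g (- t)) (at t)" for t
    by (rule DERIV_chain'[of uminus "-1", simplified]) (auto intro!: derivative_eq_intros G)
  have g': "- g (- t) \<le> C * exp (K * t)" "g (- t) \<le> C * exp (K * t)" "g t \<le> C * exp (K * t)"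
    "- g t \<le> C * exp (K * t)" if "t \<ge> 0" for t
    using g[of t] g[of "- t"] that by auto
  show ?thesis
  proof (cases "t \<ge> 0")
    case True
    with pos[of G g t, OF G] pos[of "\<lambda>t. - G t" "\<lambda>t. - g t" t, OF DERIV_minus[OF G]] G0 g'
    show ?thesis by (simp add: abs_le_iff)
  next
    case False
    with pos[of "\<lambda>t. G (- t)" "\<lambda>t. - g (- t)" "- t", OF G']
      pos[of "\<lambda>t. - G (- t)" "\<lambda>t. g (- t)" "- t"] DERIV_minus[OF G'] G0 g'
    show ?thesis by (simp add: abs_le_iff)
  qed
qed

lemma antiderivative_exists_UNIV:
  fixes f :: "real \<Rightarrow> real"
  assumes f: "continuous_on UNIV f"
  shows "\<exists>F. F 0 = 0 \<and> (\<forall>t. (F has_real_derivative f t) (at t))"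
proof -
  \<comment> \<open>For each \<open>t \<noteq> 0\<close> one of the two intervals is empty, so this
    is the oriented integral from \<open>0\<close> to \<open>t\<close>.\<close>
  define F where "F t = integral {0..t} f - integral {t..0} f" for t
  have "(F has_real_derivative f t) (at t)" for t
  proof -
    \<comment> \<open>On an open interval around both \<open>0\<close> and \<open>t\<close>,
      \<open>F\<close> agrees up to a constant with the integral based at \<open>-N\<close>, which
      covers both signs of \<open>t\<close> at once.\<close>
    define N where "N = \<bar>t\<bar> + 1"
    have cont: "continuous_on S f" for S using f continuous_on_subset by blast
    have int: "f integrable_on {u..v}" for u v by (rule integrable_continuous_real[OF cont])
    have F_eq: "F u = integral {-N..u} f - integral {-N..0} f" if "u \<in> {-N<..<N}" for u
    proof (cases "u \<ge> 0")
      case True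
      have "integral {-N..0} f + integral {0..u} f = integral {-N..u} f"
        using True by (intro Henstock_Kurzweil_Integration.integral_combine int) (auto simp: N_def)
      moreover have "integral {u..0} f = 0" using True by (cases "u = 0") auto
      ultimately show ?thesis by (simp add: F_def)
    next
      case False
      have "integral {-N..u} f + integral {u..0} f = integral {-N..0} f"
        using False that by (intro Henstock_Kurzweil_Integration.integral_combine int) auto
      then show ?thesis using False by (simp add: F_def)
    qed
    have t: "t \<in> {-N<..<N}" by (auto simp: N_def)
    have "((\<lambda>u. integral {-N..u} f) has_real_derivative f t) (at t within {-N..N})"
      using t by (intro integral_has_real_derivative cont) auto
    then have "((\<lambda>u. integral {-N..u} f) has_real_derivative f t) (at t)"
      using at_within_interior[of t "{-N..N}"] t by simp
    then have "((\<lambda>u. integral {-N..u} f - integral {-N..0} f) has_real_derivative f t) (at t)"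
      by (auto intro!: derivative_eq_intros)
    then show ?thesis
      by (rule has_field_derivative_transform_within_open[where S = "{-N<..<N}"])
        (use t in \<open>auto simp: F_eq\<close>)
  qed
  then show ?thesis by (intro exI[of _ F]) (simp add: F_def)
qed

text \<open>
  Picard iteration contracts in the norm weighted by \<open>exp (- K * \<bar>t\<bar>)\<close> with \<open>K > L\<close>, so the solution is
  obtained on the whole line at once.
\<close>

lemma lipschitz_ode_solution_exists:
  fixes f :: "real \<Rightarrow> real \<Rightarrow> real"
  assumes cont: "continuous_on UNIV (\<lambda>p. f (fst p) (snd p))"
    and bdd: "\<And>t y. \<bar>f t y\<bar> \<le> M" and lip: "\<And>t y z. \<bar>f t y - f t z\<bar> \<le> L * \<bar>y - z\<bar>"
  shows "\<exists>\<theta>. \<theta> 0 = x \<and> (\<forall>t. (\<theta> has_real_derivative f t (\<theta> t)) (at t))"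
proof -
  have L: "L \<ge> 0" using lip[of 0 1 0] by simp
  have M: "M \<ge> 0" using bdd[of 0 0] by linarith
  \<comment> \<open>Any \<open>K > L\<close> gives the contraction factor \<open>L / K < 1\<close>;
    the summand \<open>1\<close> keeps \<open>K\<close> positive when \<open>L = 0\<close>.\<close>
  define K where "K = 2 * L + 1"
  have K: "K > 0" "L / K < 1" "L / K \<ge> 0" using L by (auto simp: K_def field_simps)
  \<comment> \<open>The solution is sought as \<open>x + exp (K * \<bar>t\<bar>) * z t\<close> with
    \<open>z\<close> bounded and continuous. Moving the weight into the unknown turns the weighted
    norm into the sup norm, in which the space is complete.\<close>
  define rhs where "rhs z t = f t (x + exp (K * \<bar>t\<bar>) * apply_bcontfun z t)"
    for z :: "real \<Rightarrow>\<^sub>C real" and t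
  have rhs_cont: "continuous_on UNIV (rhs z)" for z
    unfolding rhs_def
    by (rule continuous_on_compose2[OF cont, where f = "\<lambda>t. (t, x + exp (K * \<bar>t\<bar>) * apply_bcontfun z t)", simplified])
      (intro continuous_intros continuous_on_apply_bcontfun)
  define A where "A z = (SOME F. F 0 = 0 \<and> (\<forall>t. (F has_real_derivative rhs z t) (at t)))" for z
  have A: "A z 0 = 0" "(A z has_real_derivative rhs z t) (at t)" for z t
    using someI_ex[OF antiderivative_exists_UNIV[OF rhs_cont[of z]]] unfolding A_def by auto
  have Abd: "\<bar>A z t\<bar> \<le> M / K * (exp (K * \<bar>t\<bar>) - 1)" for z t
  proof (rule abs_le_exp_growth[OF A(2,1)])
    fix t
    have "\<bar>rhs z t\<bar> \<le> M * 1" using bdd by (simp add: rhs_def)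
    also have "\<dots> \<le> M * exp (K * \<bar>t\<bar>)" using M K by (intro mult_left_mono) auto
    finally show "\<bar>rhs z t\<bar> \<le> M * exp (K * \<bar>t\<bar>)" .
  qed (use K in auto)
  define T where "T z = Bcontfun (\<lambda>t. exp (- (K * \<bar>t\<bar>)) * A z t)" for z
  have T: "apply_bcontfun (T z) t = exp (- (K * \<bar>t\<bar>)) * A z t" for z t
  proof -
    have "continuous_on UNIV (A z)"
      using A(2) by (meson DERIV_isCont continuous_at_imp_continuous_on)
    then have "(\<lambda>t. exp (- (K * \<bar>t\<bar>)) * A z t) \<in> bcontfun"
    proof (intro bcontfun_normI[where b = "M / K"] continuous_intros)
      fix t
      have "exp (- (K * \<bar>t\<bar>)) * \<bar>A z t\<bar> \<le> exp (- (K * \<bar>t\<bar>)) * (M / K * exp (K * \<bar>t\<bar>))"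
        using Abd[of z t] divide_nonneg_pos[OF M K(1)]
        by (intro mult_left_mono) (auto simp: right_diff_distrib)
      also have "\<dots> = M / K" by (simp add: exp_minus field_simps)
      finally show "norm (exp (- (K * \<bar>t\<bar>)) * A z t) \<le> M / K" by (simp add: abs_mult)
    qed
    then show ?thesis unfolding T_def by (simp add: Bcontfun_inverse)
  qed
  have "\<exists>!z. T z = z"
  proof (rule banach_fix_type[of "L / K"], goal_cases)
    case 3
    show ?case
    proof (intro allI dist_bound)
      fix z w t
      have "((\<lambda>t. A z t - A w t) has_real_derivative rhs z t - rhs w t) (at t)" for t
        by (intro derivative_intros A)
      then have "\<bar>A z t - A w t\<bar> \<le> L * dist z w / K * (exp (K * \<bar>t\<bar>) - 1)"
      proof (rule abs_le_exp_growth)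
        fix t
        have "\<bar>rhs z t - rhs w t\<bar> \<le> L * (exp (K * \<bar>t\<bar>) * \<bar>apply_bcontfun z t - apply_bcontfun w t\<bar>)"
          using lip[of t "x + exp (K * \<bar>t\<bar>) * apply_bcontfun z t" "x + exp (K * \<bar>t\<bar>) * apply_bcontfun w t"]
          by (simp add: rhs_def right_diff_distrib[symmetric] abs_mult)
        also have "\<dots> \<le> L * (exp (K * \<bar>t\<bar>) * dist z w)"
          using dist_bounded[of z t w] L by (intro mult_left_mono) (auto simp: dist_real_def)
        finally show "\<bar>rhs z t - rhs w t\<bar> \<le> L * dist z w * exp (K * \<bar>t\<bar>)" by (simp add: mult_ac)
      qed (use K A in auto)
      also have "\<dots> \<le> L * dist z w / K * exp (K * \<bar>t\<bar>)"
        using L K by (intro mult_left_mono) auto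
      finally have "exp (- (K * \<bar>t\<bar>)) * \<bar>A z t - A w t\<bar> \<le> exp (- (K * \<bar>t\<bar>)) * (L * dist z w / K * exp (K * \<bar>t\<bar>))"
        by (intro mult_left_mono) auto
      also have "\<dots> = L / K * dist z w" by (simp add: exp_minus field_simps)
      finally show "dist (apply_bcontfun (T z) t) (apply_bcontfun (T w) t) \<le> L / K * dist z w"
        by (simp add: T dist_real_def right_diff_distrib[symmetric] abs_mult)
    qed
  qed (use K in auto)
  then obtain z where z: "T z = z" by blast
  have Az: "exp (K * \<bar>t\<bar>) * apply_bcontfun z t = A z t" for t
    using T[of z t] z by (simp add: exp_minus field_simps)
  have "((\<lambda>t. x + A z t) has_real_derivative f t (x + A z t)) (at t)" for t
    using A(2)[of z t] by (auto simp: rhs_def Az intro!: derivative_eq_intros)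
  with A(1) show ?thesis by (intro exI[of _ "\<lambda>t. x + A z t"]) auto
qed

section \<open>Solutions on the torus\<close>

lemma abs_cos_diff_le: "\<bar>cos y - cos z\<bar> \<le> \<bar>y - z\<bar>" for y z :: real
proof -
  have "\<bar>cos y - cos z\<bar> = 2 * (\<bar>sin ((y + z) / 2)\<bar> * \<bar>sin ((z - y) / 2)\<bar>)"
    by (simp add: cos_diff_cos abs_mult)
  also have "\<dots> \<le> 2 * (1 * \<bar>(z - y) / 2\<bar>)"
    by (intro mult_left_mono mult_mono abs_sin_x_le_abs_x) auto
  finally show ?thesis by (simp add: abs_minus_commute)
qed

text \<open>Intermediate values with no order assumed between \<open>a\<close> and \<open>b\<close>,
  so that times before and after \<open>0\<close> need no separate treatment.\<close>

lemma isCont_attains_between: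
  fixes f :: "real \<Rightarrow> real"
  assumes "\<And>x. isCont f x" "f a \<le> y" "y \<le> f b"
  shows "\<exists>x. f x = y"
proof -
  have "connected (range f)"
    using assms(1) by (intro connected_continuous_image continuous_at_imp_continuous_on) auto
  then have "{f a..f b} \<subseteq> range f"
    by (rule connected_contains_Icc) auto
  with assms show ?thesis by (metis atLeastAtMost_iff rangeE subsetD)
qed

lemma torus_solution_exists: "\<exists>\<theta>. torus_solution a l s \<theta> \<and> \<theta> 0 = x"
proof -
  have "\<exists>\<theta>. \<theta> 0 = x \<and> (\<forall>t. (\<theta> has_real_derivative (a * cos (\<theta> t) + l + s * cos t)) (at t))"
  proof (rule lipschitz_ode_solution_exists[where M = "\<bar>a\<bar> + \<bar>l\<bar> + \<bar>s\<bar>" and L = "\<bar>a\<bar>"])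
    show "continuous_on UNIV (\<lambda>p :: real \<times> real. a * cos (snd p) + l + s * cos (fst p))"
      by (intro continuous_intros)
    fix t y z :: real
    have "\<bar>a * cos y\<bar> \<le> \<bar>a\<bar>" "\<bar>s * cos t\<bar> \<le> \<bar>s\<bar>"
      by (auto simp: abs_mult intro: mult_left_le)
    then show "\<bar>a * cos y + l + s * cos t\<bar> \<le> \<bar>a\<bar> + \<bar>l\<bar> + \<bar>s\<bar>" by linarith
    have "\<bar>a * cos y + l + s * cos t - (a * cos z + l + s * cos t)\<bar> = \<bar>a\<bar> * \<bar>cos y - cos z\<bar>"
      by (simp add: right_diff_distrib[symmetric] abs_mult)
    also have "\<dots> \<le> \<bar>a\<bar> * \<bar>y - z\<bar>"
      by (intro mult_left_mono abs_cos_diff_le) auto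
    finally show "\<bar>a * cos y + l + s * cos t - (a * cos z + l + s * cos t)\<bar> \<le> \<bar>a\<bar> * \<bar>y - z\<bar>" .
  qed
  then show ?thesis by (auto simp: torus_solution_def)
qed

lemma torus_solution_has_derivative:
  "torus_solution a l s \<theta> \<Longrightarrow> (\<theta> has_real_derivative (a * cos (\<theta> t) + l + s * cos t)) (at t)"
  by (simp add: torus_solution_def)

lemma torus_solution_isCont: "torus_solution a l s \<theta> \<Longrightarrow> isCont \<theta> t"
  by (blast intro: DERIV_isCont torus_solution_has_derivative)

section \<open>Symmetries of the torus equation\<close>

lemma torus_solution_add_period:
  assumes "torus_solution a l s \<theta>"
  shows "torus_solution a l s (\<lambda>t. \<theta> t + 2 * pi * of_int n)"
proof -
  have "cos (y + 2 * pi * of_int n) = cos y" for y :: real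
    by (metis cos_int_2pin cos_add mult.right_neutral sin_int_2pin mult_zero_right diff_zero)
  then show ?thesis
    using assms unfolding torus_solution_def by (auto intro!: derivative_eq_intros)
qed

lemma torus_solution_shift_time:
  assumes "torus_solution a l s \<theta>"
  shows "torus_solution a l s (\<lambda>t. \<theta> (t + 2 * pi * of_nat n))"
proof -
  have c: "cos (y + 2 * pi * of_nat n) = cos y" for y :: real
    by (metis cos_int_2pin cos_add mult.right_neutral sin_int_2pin mult_zero_right diff_zero of_int_of_nat_eq)
  show ?thesis
    unfolding torus_solution_def
  proof
    fix t
    have "((\<lambda>t. \<theta> (t + 2 * pi * of_nat n)) has_real_derivative
        a * cos (\<theta> (t + 2 * pi * of_nat n)) + l + s * cos (t + 2 * pi * of_nat n)) (at t)"
      by (rule DERIV_shift[THEN iffD1, OF torus_solution_has_derivative[OF assms]])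
    then show "((\<lambda>t. \<theta> (t + 2 * pi * of_nat n)) has_real_derivative
        a * cos (\<theta> (t + 2 * pi * of_nat n)) + l + s * cos t) (at t)"
      by (simp only: c)
  qed
qed

text \<open>Cosine is even, so reversing time and negating the angle together preserve the equation.
  This reversal is what pairs the fixed points \<open>p\<close> and \<open>- p\<close>.\<close>

lemma torus_solution_reflect:
  assumes "torus_solution a l s \<theta>"
  shows "torus_solution a l s (\<lambda>t. - \<theta> (- t))"
  unfolding torus_solution_def
proof
  fix t
  have "((\<lambda>t. - \<theta> (- t)) has_real_derivative - ((a * cos (\<theta> (- t)) + l + s * cos (- t)) * - 1)) (at t)"
    by (intro DERIV_minus DERIV_chain'[of uminus "-1"] torus_solution_has_derivative[OF assms])
      (auto intro!: derivative_eq_intros)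
  then show "((\<lambda>t. - \<theta> (- t)) has_real_derivative a * cos (- \<theta> (- t)) + l + s * cos t) (at t)"
    by (simp add: algebra_simps)
qed

section \<open>Moebius structure of the flow\<close>

text \<open>The linearised equation along \<open>\<theta>\<close> is
  \<open>\<delta>' = - a * sin (\<theta> t) * \<delta>\<close>, so along a solution this is the
  square root of the derivative of the flow in the initial angle.\<close>

definition multiplier :: "real \<Rightarrow> (real \<Rightarrow> real) \<Rightarrow> real \<Rightarrow> real" where
  "multiplier a \<theta> t =
     exp (- (a / 2) * (SOME F. F 0 = 0 \<and> (\<forall>t. (F has_real_derivative sin (\<theta> t)) (at t))) t)"

text \<open>
  The equation is a Riccati equation in \<open>tan (\<theta> / 2)\<close>, so its flow acts on the circle by Moebius maps. This is
  the corresponding statement for the chordal differences \<open>sin ((\<theta> - \<eta>) / 2)\<close>.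
\<close>

lemma sin_half_diff_torus_solutions:
  assumes \<theta>: "torus_solution a l s \<theta>" and \<eta>: "torus_solution a l s \<eta>"
  shows "sin ((\<theta> t - \<eta> t) / 2) = sin ((\<theta> 0 - \<eta> 0) / 2) * multiplier a \<theta> t * multiplier a \<eta> t"
proof -
  define I where "I \<zeta> = (SOME F. F 0 = 0 \<and> (\<forall>t. (F has_real_derivative sin (\<zeta> t)) (at t)))" for \<zeta> :: "real \<Rightarrow> real"
  have I: "I \<zeta> 0 = 0" "(I \<zeta> has_real_derivative sin (\<zeta> t)) (at t)" if "torus_solution a l s \<zeta>" for \<zeta> t
  proof -
    have "continuous_on UNIV (\<lambda>t. sin (\<zeta> t))"
      using torus_solution_isCont[OF that] by (intro continuous_at_imp_continuous_on ballI) simp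
    from someI_ex[OF antiderivative_exists_UNIV[OF this]]
    show "I \<zeta> 0 = 0" "(I \<zeta> has_real_derivative sin (\<zeta> t)) (at t)" unfolding I_def by auto
  qed
  have m: "multiplier a \<zeta> t = exp (- (a / 2) * I \<zeta> t)" for \<zeta> t
    by (simp add: multiplier_def I_def)
  \<comment> \<open>The chordal difference divided by both multipliers. In terms of the half sum
    \<open>x\<close> and half difference \<open>y\<close>, the two terms of its derivative are
    opposite multiples of \<open>a * sin x * sin y * cos y\<close>.\<close>
  define h where "h t = sin ((\<theta> t - \<eta> t) / 2) * exp ((a / 2) * (I \<theta> t + I \<eta> t))" for t
  have "(h has_real_derivative 0) (at t)" for t
  proof -
    define x y e where "x = (\<theta> t + \<eta> t) / 2" and "y = (\<theta> t - \<eta> t) / 2"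
      and "e = exp ((a / 2) * (I \<theta> t + I \<eta> t))"
    have eqs: "\<theta> t = x + y" "\<eta> t = x - y" by (auto simp: x_def y_def field_simps)
    have "(h has_real_derivative
        cos y * ((a * cos (\<theta> t) + l + s * cos t - (a * cos (\<eta> t) + l + s * cos t)) / 2) * e
        + sin y * (e * ((a / 2) * (sin (\<theta> t) + sin (\<eta> t))))) (at t)"
      unfolding h_def y_def e_def
      by (auto intro!: derivative_eq_intros torus_solution_has_derivative[OF \<theta>]
          torus_solution_has_derivative[OF \<eta>] I[OF \<theta>] I[OF \<eta>] simp: field_simps)
    moreover have "cos y * ((a * cos (\<theta> t) + l + s * cos t - (a * cos (\<eta> t) + l + s * cos t)) / 2) * e
        + sin y * (e * ((a / 2) * (sin (\<theta> t) + sin (\<eta> t)))) = 0"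
      unfolding eqs by (simp add: sin_add cos_add sin_diff cos_diff algebra_simps)
    ultimately show ?thesis by simp
  qed
  then have "h t = h 0" by (rule DERIV_isconst_all[OF allI])
  then have h: "sin ((\<theta> t - \<eta> t) / 2) * exp ((a / 2) * (I \<theta> t + I \<eta> t)) = sin ((\<theta> 0 - \<eta> 0) / 2)"
    by (simp add: h_def I[OF \<theta>] I[OF \<eta>])
  have "sin ((\<theta> 0 - \<eta> 0) / 2) * multiplier a \<theta> t * multiplier a \<eta> t
      = sin ((\<theta> t - \<eta> t) / 2) * (exp ((a / 2) * (I \<theta> t + I \<eta> t)) * (multiplier a \<theta> t * multiplier a \<eta> t))"
    unfolding h[symmetric] by (simp only: mult.assoc)
  also have "exp ((a / 2) * (I \<theta> t + I \<eta> t)) * (multiplier a \<theta> t * multiplier a \<eta> t) = 1"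
    unfolding m exp_add[symmetric] by (simp add: algebra_simps)
  finally show ?thesis by simp
qed

lemma multiplier_pos: "multiplier a \<theta> t > 0"
  by (simp add: multiplier_def)

text \<open>The multipliers are positive, so the chordal difference never vanishes and by continuity
  the angle difference cannot reach \<open>0\<close> or \<open>2 * pi\<close>.\<close>

lemma torus_solution_diff_between:
  assumes \<theta>: "torus_solution a l s \<theta>" and \<eta>: "torus_solution a l s \<eta>"
    and "0 < \<theta> 0 - \<eta> 0" "\<theta> 0 - \<eta> 0 < 2 * pi"
  shows "0 < \<theta> t - \<eta> t" "\<theta> t - \<eta> t < 2 * pi"
proof -
  have "sin ((\<theta> 0 - \<eta> 0) / 2) > 0"
    using assms by (intro sin_gt_zero) auto
  then have "sin ((\<theta> u - \<eta> u) / 2) \<noteq> 0" for u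
    using sin_half_diff_torus_solutions[OF \<theta> \<eta>, of u] multiplier_pos[of a \<theta> u] multiplier_pos[of a \<eta> u]
    by simp
  then have ne: "\<theta> u - \<eta> u \<noteq> 0" "\<theta> u - \<eta> u \<noteq> 2 * pi" for u
    by (metis div_0 sin_zero, metis nonzero_mult_div_cancel_left sin_pi zero_neq_numeral)
  have cont: "isCont (\<lambda>u. \<theta> u - \<eta> u) u" for u
    by (intro continuous_intros torus_solution_isCont[OF \<theta>] torus_solution_isCont[OF \<eta>])
  show "0 < \<theta> t - \<eta> t"
    using isCont_attains_between[of "\<lambda>u. \<theta> u - \<eta> u" t 0 0, OF cont] ne assms by force
  show "\<theta> t - \<eta> t < 2 * pi"
    using isCont_attains_between[of "\<lambda>u. \<theta> u - \<eta> u" 0 "2 * pi" t, OF cont] ne assms by force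
qed

text \<open>The chordal difference vanishes at all times, so the angle difference takes only values
  in \<open>2 * pi\<close> times the integers and, being continuous, stays \<open>0\<close>.\<close>

lemma torus_solution_unique:
  assumes \<theta>: "torus_solution a l s \<theta>" and \<eta>: "torus_solution a l s \<eta>" and "\<theta> 0 = \<eta> 0"
  shows "\<theta> = \<eta>"
proof (rule ccontr)
  assume "\<theta> \<noteq> \<eta>"
  then obtain t where t: "\<theta> t \<noteq> \<eta> t" by blast
  have zero: "sin ((\<theta> u - \<eta> u) / 2) = 0" for u
    using sin_half_diff_torus_solutions[OF \<theta> \<eta>, of u] assms by simp
  have cont: "isCont (\<lambda>u. \<theta> u - \<eta> u) u" "isCont (\<lambda>u. \<eta> u - \<theta> u) u" for u
    by (intro continuous_intros torus_solution_isCont[OF \<theta>] torus_solution_isCont[OF \<eta>])+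
  \<comment> \<open>The cap at \<open>pi\<close> ensures \<open>sin (y / 2) > 0\<close>, so that
    attaining \<open>y\<close> is absurd.\<close>
  define y where "y = min \<bar>\<theta> t - \<eta> t\<bar> pi"
  have y: "0 < y" "y \<le> pi" using t by (auto simp: y_def)
  have "\<exists>u. \<bar>\<theta> u - \<eta> u\<bar> = y"
  proof (cases "\<theta> t > \<eta> t")
    case True
    then have "\<exists>u. \<theta> u - \<eta> u = y"
      using assms y by (intro isCont_attains_between[of "\<lambda>u. \<theta> u - \<eta> u" 0 y t, OF cont(1)]) (auto simp: y_def)
    then obtain u where "\<theta> u - \<eta> u = y" ..
    with y show ?thesis by (intro exI[of _ u]) simp
  next
    case False
    then have "\<exists>u. \<eta> u - \<theta> u = y"
      using assms y by (intro isCont_attains_between[of "\<lambda>u. \<eta> u - \<theta> u" 0 y t, OF cont(2)]) (auto simp: y_def)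
    then obtain u where "\<eta> u - \<theta> u = y" ..
    with y show ?thesis by (intro exI[of _ u]) simp
  qed
  then obtain u where u: "\<bar>\<theta> u - \<eta> u\<bar> = y" ..
  have "sin (y / 2) > 0" using y by (intro sin_gt_zero) auto
  moreover have "\<theta> u - \<eta> u = y \<or> \<theta> u - \<eta> u = - y" using u by linarith
  then have "sin (y / 2) = 0" using zero[of u] by (elim disjE) simp_all
  ultimately show False by simp
qed

text \<open>Adding a multiple of \<open>2 * pi\<close> to \<open>\<eta>\<close> brings the initial
  difference into \<open>[0, 2 * pi)\<close>, where it then remains. This bound makes the rotation
  limit exist and be independent of the solution.\<close>

lemma torus_solution_diff_bounded:
  assumes \<theta>: "torus_solution a l s \<theta>" and \<eta>: "torus_solution a l s \<eta>"
  shows "\<bar>(\<theta> t - \<eta> t) - (\<theta> 0 - \<eta> 0)\<bar> \<le> 2 * pi"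
proof -
  define n where "n = \<lfloor>(\<theta> 0 - \<eta> 0) / (2 * pi)\<rfloor>"
  define \<zeta> where "\<zeta> t = \<eta> t + 2 * pi * of_int n" for t
  have \<zeta>: "torus_solution a l s \<zeta>"
    unfolding \<zeta>_def by (rule torus_solution_add_period[OF \<eta>])
  have "of_int n \<le> (\<theta> 0 - \<eta> 0) / (2 * pi)" "(\<theta> 0 - \<eta> 0) / (2 * pi) < of_int n + 1"
    unfolding n_def by linarith+
  then have b: "0 \<le> \<theta> 0 - \<zeta> 0" "\<theta> 0 - \<zeta> 0 < 2 * pi"
    by (auto simp: \<zeta>_def field_simps)
  show ?thesis
  proof (cases "\<theta> 0 = \<zeta> 0")
    case True
    then have "\<theta> = \<zeta>" by (intro torus_solution_unique[OF \<theta> \<zeta>])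
    then show ?thesis by (simp add: \<zeta>_def)
  next
    case False
    then have "0 < \<theta> t - \<zeta> t" "\<theta> t - \<zeta> t < 2 * pi"
      using torus_solution_diff_between[OF \<theta> \<zeta>] b by auto
    with b show ?thesis by (auto simp: \<zeta>_def)
  qed
qed

text \<open>A Gronwall estimate, for the square of the difference in order to keep it differentiable.\<close>

lemma torus_solution_dependence:
  assumes \<theta>: "torus_solution a l s \<theta>" and \<eta>: "torus_solution a' l' s' \<eta>" and "t \<ge> 0"
  shows "(\<eta> t - \<theta> t)\<^sup>2 \<le> exp ((2 * \<bar>a\<bar> + 1) * t) *
    ((\<eta> 0 - \<theta> 0)\<^sup>2 + (\<bar>a' - a\<bar> + \<bar>l' - l\<bar> + \<bar>s' - s\<bar>)\<^sup>2 * t)"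
proof -
  \<comment> \<open>The summand \<open>2 * \<bar>a\<bar>\<close> comes from the Lipschitz constant;
    the \<open>1\<close> absorbs the cross term through
    \<open>2 * \<bar>d\<bar> * e \<le> d\<^sup>2 + e\<^sup>2\<close>.\<close>
  define K where "K = 2 * \<bar>a\<bar> + 1"
  define e where "e = \<bar>a' - a\<bar> + \<bar>l' - l\<bar> + \<bar>s' - s\<bar>"
  define d where "d t = \<eta> t - \<theta> t" for t
  define d' where "d' t = a' * cos (\<eta> t) + l' + s' * cos t - (a * cos (\<theta> t) + l + s * cos t)" for t
  have d: "(d has_real_derivative d' t) (at t)" for t
    unfolding d_def d'_def
    by (intro derivative_intros torus_solution_has_derivative[OF \<theta>] torus_solution_has_derivative[OF \<eta>])
  have d'_le: "\<bar>d' t\<bar> \<le> \<bar>a\<bar> * \<bar>d t\<bar> + e" for t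
  proof -
    have "d' t = a * (cos (\<eta> t) - cos (\<theta> t)) + (a' - a) * cos (\<eta> t) + (l' - l) + (s' - s) * cos t"
      by (simp add: d'_def algebra_simps)
    moreover have "\<bar>a * (cos (\<eta> t) - cos (\<theta> t))\<bar> \<le> \<bar>a\<bar> * \<bar>d t\<bar>"
      unfolding abs_mult d_def by (intro mult_left_mono abs_cos_diff_le) auto
    moreover have "\<bar>(a' - a) * cos (\<eta> t)\<bar> \<le> \<bar>a' - a\<bar>" "\<bar>(s' - s) * cos t\<bar> \<le> \<bar>s' - s\<bar>"
      by (auto simp: abs_mult intro: mult_left_le)
    ultimately show ?thesis unfolding e_def by linarith
  qed
  have "exp (- (K * t)) * (d t)\<^sup>2 - e\<^sup>2 * t \<le> exp (- (K * 0)) * (d 0)\<^sup>2 - e\<^sup>2 * 0"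
  proof (rule DERIV_nonpos_imp_nonincreasing[OF \<open>t \<ge> 0\<close>])
    fix u :: real assume u: "0 \<le> u"
    have "((\<lambda>t. exp (- (K * t)) * (d t)\<^sup>2 - e\<^sup>2 * t) has_real_derivative
        exp (- (K * u)) * (2 * d u * d' u - K * (d u)\<^sup>2) - e\<^sup>2) (at u)"
      by (auto intro!: derivative_eq_intros d simp: algebra_simps)
    moreover have "exp (- (K * u)) * (2 * d u * d' u - K * (d u)\<^sup>2) \<le> e\<^sup>2"
    proof -
      have "2 * d u * d' u \<le> 2 * (\<bar>d u\<bar> * \<bar>d' u\<bar>)"
        by (metis abs_ge_self abs_mult mult.assoc mult_left_mono zero_le_numeral)
      also have "\<dots> \<le> 2 * (\<bar>d u\<bar> * (\<bar>a\<bar> * \<bar>d u\<bar> + e))"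
        by (intro mult_left_mono d'_le) auto
      also have "\<dots> = 2 * \<bar>a\<bar> * (d u)\<^sup>2 + 2 * \<bar>d u\<bar> * e"
        by (simp add: algebra_simps power2_eq_square)
      also have "2 * \<bar>d u\<bar> * e \<le> (d u)\<^sup>2 + e\<^sup>2"
        using sum_squares_bound[of "\<bar>d u\<bar>" e] by simp
      finally have "2 * d u * d' u - K * (d u)\<^sup>2 \<le> e\<^sup>2" by (simp add: K_def algebra_simps)
      then have "exp (- (K * u)) * (2 * d u * d' u - K * (d u)\<^sup>2) \<le> exp (- (K * u)) * e\<^sup>2"
        by (intro mult_left_mono) auto
      also have "\<dots> \<le> 1 * e\<^sup>2" using u by (intro mult_right_mono) (auto simp: K_def)
      finally show ?thesis by simp
    qed
    ultimately show "\<exists>y. ((\<lambda>t. exp (- (K * t)) * (d t)\<^sup>2 - e\<^sup>2 * t) has_real_derivative y) (at u) \<and> y \<le> 0"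
      by (intro exI[of _ "exp (- (K * u)) * (2 * d u * d' u - K * (d u)\<^sup>2) - e\<^sup>2"]) simp
  qed
  then have "exp (- (K * t)) * (d t)\<^sup>2 \<le> (d 0)\<^sup>2 + e\<^sup>2 * t" by simp
  then have "exp (K * t) * (exp (- (K * t)) * (d t)\<^sup>2) \<le> exp (K * t) * ((d 0)\<^sup>2 + e\<^sup>2 * t)"
    by (intro mult_left_mono) auto
  then show ?thesis
    by (simp add: exp_minus d_def e_def K_def mult.assoc[symmetric])
qed

text \<open>Where the solutions meet, their difference has slope \<open>l' - l > 0\<close>, so it
  cannot turn negative: its last zero before a negative value would be followed by another zero.
  Once it is nonnegative, the weight \<open>exp (\<bar>a\<bar> * t)\<close> absorbs the cosine term
  and gives strict growth.\<close>

lemma torus_solution_strict_mono_l: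
  assumes \<theta>: "torus_solution a l s \<theta>" and \<eta>: "torus_solution a l' s \<eta>"
    and "\<theta> 0 = \<eta> 0" "l < l'" "t > 0"
  shows "\<theta> t < \<eta> t"
proof -
  define d where "d t = \<eta> t - \<theta> t" for t
  define d' where "d' t = l' - l + a * (cos (\<eta> t) - cos (\<theta> t))" for t
  have d: "(d has_real_derivative d' t) (at t)" for t
    unfolding d_def d'_def
    by (auto intro!: derivative_eq_intros torus_solution_has_derivative[OF \<theta>]
        torus_solution_has_derivative[OF \<eta>] simp: algebra_simps)
  then have cont: "continuous_on S d" for S
    by (meson DERIV_isCont continuous_at_imp_continuous_on)
  have d0: "d 0 = 0" using assms by (simp add: d_def)
  have nonneg: "d u \<ge> 0" if "u \<ge> 0" for u
  proof (rule ccontr)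
    assume neg: "\<not> d u \<ge> 0"
    define S where "S = {v \<in> {0..u}. d v = 0}"
    have "closed S"
      unfolding S_def using cont by (intro continuous_closed_preimage_constant) auto
    then have "compact S"
      by (intro compact_eq_bounded_closed[THEN iffD2] conjI bounded_subset[of "{0..u}" S])
        (auto simp: S_def)
    moreover have "0 \<in> S" using d0 that by (auto simp: S_def)
    ultimately obtain v where v: "v \<in> S" "\<And>w. w \<in> S \<Longrightarrow> w \<le> v"
      by (metis compact_attains_sup empty_iff)
    then have "d v = 0" "0 \<le> v" "v \<le> u" by (auto simp: S_def)
    then have "\<eta> v = \<theta> v" by (simp add: d_def)
    then have "d' v > 0" using assms by (simp add: d'_def)
    from DERIV_pos_inc_right[OF d this] obtain h where h: "h > 0" "\<And>k. 0 < k \<Longrightarrow> k < h \<Longrightarrow> d v < d (v + k)"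
      by auto
    have "v < u" using neg \<open>d v = 0\<close> \<open>v \<le> u\<close> by (cases "v = u") auto
    define w where "w = v + min (h / 2) (u - v)"
    have w: "v < w" "w \<le> u" using h \<open>v < u\<close> by (auto simp: w_def)
    have "d w > 0" using h(2)[of "w - v"] h(1) \<open>d v = 0\<close> \<open>v < u\<close> by (auto simp: w_def)
    then obtain z where "w \<le> z" "z \<le> u" "d z = 0"
      using IVT2'[of d u 0 w] neg w cont by (metis less_eq_real_def linear not_less)
    then have "z \<in> S" using w \<open>0 \<le> v\<close> by (auto simp: S_def)
    with v(2) w \<open>w \<le> z\<close> show False by fastforce
  qed
  have "exp (\<bar>a\<bar> * 0) * d 0 < exp (\<bar>a\<bar> * t) * d t"
  proof (rule DERIV_pos_imp_increasing[OF \<open>t > 0\<close>])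
    fix u :: real assume u: "0 \<le> u"
    have "((\<lambda>t. exp (\<bar>a\<bar> * t) * d t) has_real_derivative exp (\<bar>a\<bar> * u) * (\<bar>a\<bar> * d u + d' u)) (at u)"
      by (auto intro!: derivative_eq_intros d simp: algebra_simps)
    moreover have "\<bar>a * (cos (\<eta> u) - cos (\<theta> u))\<bar> \<le> \<bar>a\<bar> * \<bar>d u\<bar>"
      unfolding abs_mult d_def by (intro mult_left_mono abs_cos_diff_le) auto
    then have "\<bar>a\<bar> * d u + d' u > 0"
      using nonneg[OF u] assms by (simp add: d'_def)
    ultimately show "\<exists>y. ((\<lambda>t. exp (\<bar>a\<bar> * t) * d t) has_real_derivative y) (at u) \<and> 0 < y"
      by (metis exp_gt_zero mult_pos_pos)
  qed
  then have "d t > 0" by (simp add: d0 zero_less_mult_iff)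
  then show ?thesis by (simp add: d_def)
qed

section \<open>Rotation number and Poincare map\<close>

text \<open>Comparing \<open>c (m * n)\<close> with both \<open>m * c n\<close> and
  \<open>n * c m\<close> bounds the distance of \<open>c m / m\<close> and \<open>c n / n\<close> by
  \<open>D / m + D / n\<close>, so the sequence is Cauchy.\<close>

lemma quasi_additive_convergent:
  fixes c :: "nat \<Rightarrow> real"
  assumes c: "\<And>m n. \<bar>c (m + n) - c m - c n\<bar> \<le> D"
  shows "convergent (\<lambda>n. c n / n)"
proof -
  have mult: "\<bar>c (Suc m * n) - Suc m * c n\<bar> \<le> m * D" for m n
  proof (induction m)
    case (Suc m)
    have "\<bar>c (Suc (Suc m) * n) - Suc (Suc m) * c n\<bar>
        \<le> \<bar>c (Suc m * n) - Suc m * c n\<bar> + \<bar>c (n + Suc m * n) - c n - c (Suc m * n)\<bar>"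
      by (simp add: algebra_simps abs_if)
    with Suc c[of n "Suc m * n"] show ?case by (simp add: algebra_simps)
  qed simp
  have D: "D \<ge> 0" using c[of 0 0] by linarith
  have half: "\<bar>c (m * n) / (m * n) - c n / n\<bar> \<le> D / n" if mn: "m > 0" "n > 0" for m n :: nat
  proof -
    have "\<bar>c (m * n) - m * c n\<bar> \<le> (m - 1) * D"
      using mult[of "m - 1" n] mn by simp
    also have "\<dots> \<le> m * D" using D by (intro mult_right_mono) auto
    finally have "\<bar>c (m * n) - m * c n\<bar> / (m * n) \<le> m * D / (m * n)"
      by (intro divide_right_mono) auto
    moreover have "c (m * n) / (m * n) - c n / n = (c (m * n) - m * c n) / (m * n)"
      using mn by (simp add: field_simps)
    ultimately show ?thesis using mn by (simp add: abs_mult)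
  qed
  have "Cauchy (\<lambda>n. c n / n)"
  proof (rule metric_CauchyI)
    fix e :: real assume e: "e > 0"
    obtain N :: nat where N: "N > 2 * D / e" using reals_Archimedean2 by blast
    show "\<exists>M. \<forall>m\<ge>M. \<forall>n\<ge>M. dist (c m / real m) (c n / real n) < e"
    proof (intro exI allI impI)
      fix m n assume mn: "m \<ge> Suc N" "n \<ge> Suc N"
      have small: "D / k < e / 2" if "k \<ge> Suc N" for k :: nat
      proof -
        have "2 * D < e * N" using N e by (simp add: field_simps)
        also have "\<dots> \<le> e * k" using that e by (intro mult_left_mono) auto
        finally show ?thesis using that by (simp add: field_simps)
      qed
      have "dist (c m / m) (c n / n) \<le> D / m + D / n"
        using half[of m n] half[of n m] mn by (simp add: dist_real_def mult.commute)
      with small[of m] small[of n] mn show "dist (c m / real m) (c n / real n) < e" by linarith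
    qed
  qed
  then show ?thesis by (simp add: Cauchy_convergent_iff)
qed

lemma bounded_over_nat_tendsto_0:
  fixes f :: "nat \<Rightarrow> real"
  assumes "\<And>k. \<bar>f k\<bar> \<le> C"
  shows "(\<lambda>k. f k / (2 * pi * real k)) \<longlonglongrightarrow> 0"
proof (rule Lim_null_comparison[OF always_eventually[OF allI] lim_const_over_n])
  fix k
  have "norm (f k / (2 * pi * real k)) = \<bar>f k\<bar> / (2 * pi) / real k"
    unfolding real_norm_def abs_divide divide_divide_eq_left by simp
  also have "\<dots> \<le> C / (2 * pi) / real k"
    by (intro divide_right_mono assms) simp_all
  finally show "norm (f k / (2 * pi * real k)) \<le> C / (2 * pi) / real k" .
qed

text \<open>A shift by whole periods gives another solution, whose displacement differs by at most
  \<open>2 * pi\<close>. Hence the displacement over \<open>k\<close> periods is quasi-additive, and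
  any other solution differs from it by a bounded amount.\<close>

lemma torus_solution_rotation_limit_exists:
  "\<exists>\<rho>. \<forall>\<theta>. torus_solution a l s \<theta> \<longrightarrow> (\<lambda>k::nat. \<theta> (2 * pi * real k) / (2 * pi * real k)) \<longlonglongrightarrow> \<rho>"
proof -
  obtain \<eta> where \<eta>: "torus_solution a l s \<eta>" using torus_solution_exists by blast
  define c where "c k = \<eta> (2 * pi * real k) - \<eta> 0" for k :: nat
  have "\<bar>c (m + n) - c m - c n\<bar> \<le> 2 * pi" for m n
    using torus_solution_diff_bounded[OF torus_solution_shift_time[OF \<eta>, of n] \<eta>, of "2 * pi * real m"]
    by (simp add: c_def algebra_simps)
  then obtain L where L: "(\<lambda>k. c k / k) \<longlonglongrightarrow> L"
    using quasi_additive_convergent[of c "2 * pi"] by (auto simp: convergent_def)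
  have "(\<lambda>k::nat. \<theta> (2 * pi * real k) / (2 * pi * real k)) \<longlonglongrightarrow> L / (2 * pi) + 0"
    if \<theta>: "torus_solution a l s \<theta>" for \<theta>
  proof -
    have "\<bar>\<theta> (2 * pi * real k) - c k\<bar> \<le> 2 * pi + \<bar>\<theta> 0\<bar>" for k
      using torus_solution_diff_bounded[OF \<theta> \<eta>, of "2 * pi * real k"] by (simp add: c_def)
    then have lim0: "(\<lambda>k. (\<theta> (2 * pi * real k) - c k) / (2 * pi * real k)) \<longlonglongrightarrow> 0"
      by (rule bounded_over_nat_tendsto_0)
    have "(\<lambda>k. c k / k / (2 * pi)) \<longlonglongrightarrow> L / (2 * pi)"
      by (rule tendsto_divide[OF L tendsto_const]) simp
    from tendsto_add[OF this lim0]
    have "(\<lambda>k. c k / k / (2 * pi) + (\<theta> (2 * pi * real k) - c k) / (2 * pi * real k)) \<longlonglongrightarrow> L / (2 * pi) + 0" .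
    moreover have "c k / k / (2 * pi) + (y - c k) / (2 * pi * real k) = y / (2 * pi * real k)" for y and k :: nat
      by (simp add: diff_divide_distrib)
    ultimately show ?thesis by (simp only:)
  qed
  then show ?thesis by blast
qed

lemma rotation_number_limit:
  assumes "josephson_solution B A \<omega> \<theta>"
  shows "(\<lambda>k::nat. \<theta> (2 * pi * real k) / (2 * pi * real k)) \<longlonglongrightarrow> rotation_number B A \<omega>"
proof -
  let ?P = "\<lambda>\<rho>. \<forall>\<theta>. josephson_solution B A \<omega> \<theta> \<longrightarrow>
      (\<lambda>k::nat. \<theta> (2 * pi * real k) / (2 * pi * real k)) \<longlonglongrightarrow> \<rho>"
  obtain \<rho> where \<rho>: "?P \<rho>"
    using torus_solution_rotation_limit_exists unfolding josephson_solution_def by blast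
  then have "?P (THE \<rho>. ?P \<rho>)"
    using assms LIMSEQ_unique by (intro theI[of ?P \<rho>]) blast+
  with assms show ?thesis unfolding rotation_number_def by blast
qed

section \<open>The Poincare map\<close>

text \<open>It acts on the lifted angle, so a periodic orbit of rotation number \<open>r\<close>
  shows as a point translated by exactly \<open>2 * pi * r\<close>.\<close>

definition poincare :: "real \<Rightarrow> real \<Rightarrow> real \<Rightarrow> real \<Rightarrow> real" where
  "poincare a l s x = (SOME \<theta>. torus_solution a l s \<theta> \<and> \<theta> 0 = x) (2 * pi)"

lemma poincare_eq:
  assumes "torus_solution a l s \<theta>"
  shows "poincare a l s (\<theta> 0) = \<theta> (2 * pi)"
proof -
  define \<eta> where "\<eta> = (SOME \<eta>. torus_solution a l s \<eta> \<and> \<eta> 0 = \<theta> 0)"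
  have "torus_solution a l s \<eta> \<and> \<eta> 0 = \<theta> 0"
    unfolding \<eta>_def by (rule someI_ex[OF torus_solution_exists])
  then have "\<eta> = \<theta>" using torus_solution_unique assms by blast
  then show ?thesis by (simp add: poincare_def \<eta>_def)
qed

lemma poincare_solution:
  obtains \<theta> where "torus_solution a l s \<theta>" "\<theta> 0 = x" "\<theta> (2 * pi) = poincare a l s x"
proof -
  obtain \<theta> where "torus_solution a l s \<theta>" "\<theta> 0 = x"
    using torus_solution_exists by blast
  with poincare_eq[of a l s \<theta>] that[of \<theta>] show ?thesis by simp
qed

lemma poincare_add_period: "poincare a l s (x + 2 * pi * of_int n) = poincare a l s x + 2 * pi * of_int n"
proof -
  obtain \<theta> where \<theta>: "torus_solution a l s \<theta>" "\<theta> 0 = x" "\<theta> (2 * pi) = poincare a l s x"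
    by (rule poincare_solution)
  with poincare_eq[OF torus_solution_add_period[OF \<theta>(1), of n]] show ?thesis by simp
qed

lemma poincare_strict_mono_l:
  assumes "l < l'"
  shows "poincare a l s x < poincare a l' s x"
proof -
  obtain \<theta> where "torus_solution a l s \<theta>" "\<theta> 0 = x" "\<theta> (2 * pi) = poincare a l s x"
    by (rule poincare_solution)
  moreover obtain \<eta> where "torus_solution a l' s \<eta>" "\<eta> 0 = x" "\<eta> (2 * pi) = poincare a l' s x"
    by (rule poincare_solution)
  ultimately show ?thesis
    using assms torus_solution_strict_mono_l[of a l s \<theta> l' \<eta> "2 * pi"] by simp
qed

lemma poincare_fixed_imp_periodic:
  assumes "torus_solution a l s \<theta>" "poincare a l s (\<theta> 0) = \<theta> 0 + 2 * pi * of_int r"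
  shows "\<theta> (t + 2 * pi) = \<theta> t + 2 * pi * of_int r"
proof -
  have "(\<lambda>t. \<theta> (t + 2 * pi * of_nat 1)) = (\<lambda>t. \<theta> t + 2 * pi * of_int r)"
    using assms poincare_eq[OF assms(1)]
    by (intro torus_solution_unique torus_solution_shift_time torus_solution_add_period) auto
  then show ?thesis by (simp add: fun_eq_iff)
qed

text \<open>The solution through \<open>x\<close> advances by \<open>2 * pi * r\<close> over every
  period, including the one before time \<open>0\<close>; its reflection starts at
  \<open>- x\<close> and runs through that earlier period.\<close>

lemma poincare_fixed_uminus:
  assumes "poincare a l s x = x + 2 * pi * of_int r"
  shows "poincare a l s (- x) = - x + 2 * pi * of_int r"
proof -
  obtain \<theta> where \<theta>: "torus_solution a l s \<theta>" "\<theta> 0 = x"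
    using torus_solution_exists by blast
  have "\<theta> 0 = \<theta> (- (2 * pi)) + 2 * pi * of_int r"
    using poincare_fixed_imp_periodic[OF \<theta>(1), of r "- (2 * pi)"] assms \<theta> by simp
  with poincare_eq[OF torus_solution_reflect[OF \<theta>(1)]] \<theta> show ?thesis by simp
qed

lemma poincare_close:
  "(poincare a' l' s' y - poincare a l s x)\<^sup>2 \<le> exp ((2 * \<bar>a\<bar> + 1) * (2 * pi)) *
    ((y - x)\<^sup>2 + (\<bar>a' - a\<bar> + \<bar>l' - l\<bar> + \<bar>s' - s\<bar>)\<^sup>2 * (2 * pi))"
proof -
  obtain \<theta> where "torus_solution a l s \<theta>" "\<theta> 0 = x" "\<theta> (2 * pi) = poincare a l s x"
    by (rule poincare_solution)
  moreover obtain \<eta> where "torus_solution a' l' s' \<eta>" "\<eta> 0 = y" "\<eta> (2 * pi) = poincare a' l' s' y"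
    by (rule poincare_solution)
  ultimately show ?thesis using torus_solution_dependence[of a l s \<theta> a' l' s' \<eta> "2 * pi"] by simp
qed

lemma continuous_on_poincare:
  assumes "continuous_on S a" "continuous_on S l" "continuous_on S s" "continuous_on S x"
  shows "continuous_on S (\<lambda>p. poincare (a p) (l p) (s p) (x p))"
  unfolding continuous_on_def
proof
  fix p assume p: "p \<in> S"
  define g where "g q = exp ((2 * \<bar>a p\<bar> + 1) * (2 * pi)) *
    ((x q - x p)\<^sup>2 + (\<bar>a q - a p\<bar> + \<bar>l q - l p\<bar> + \<bar>s q - s p\<bar>)\<^sup>2 * (2 * pi))" for q
  let ?F = "\<lambda>q. poincare (a q) (l q) (s q) (x q)"
  have "(g \<longlongrightarrow> exp ((2 * \<bar>a p\<bar> + 1) * (2 * pi)) *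
    ((x p - x p)\<^sup>2 + (\<bar>a p - a p\<bar> + \<bar>l p - l p\<bar> + \<bar>s p - s p\<bar>)\<^sup>2 * (2 * pi))) (at p within S)"
    unfolding g_def using assms p by (intro tendsto_intros) (auto simp: continuous_on_def)
  then have "(g \<longlongrightarrow> 0) (at p within S)" by simp
  then have "((\<lambda>q. (?F q - ?F p)\<^sup>2) \<longlongrightarrow> 0) (at p within S)"
    by (rule Lim_null_comparison[rotated]) (auto simp: g_def poincare_close intro!: always_eventually)
  from tendsto_real_sqrt[OF this] have "((\<lambda>q. \<bar>?F q - ?F p\<bar>) \<longlongrightarrow> 0) (at p within S)"
    by (simp del: power2_diff)
  then show "(?F \<longlongrightarrow> ?F p) (at p within S)"
    by (intro LIM_zero_cancel[of ?F]) (simp add: tendsto_rabs_zero_iff)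
qed

section \<open>Integer rotation numbers and fixed points\<close>

lemma poincare_fixed_imp_rotation_number:
  assumes "poincare (1 / \<omega>) (B / \<omega>) (A / \<omega>) x = x + 2 * pi * of_int r"
  shows "rotation_number B A \<omega> = of_int r"
proof -
  obtain \<theta> where \<theta>: "torus_solution (1 / \<omega>) (B / \<omega>) (A / \<omega>) \<theta>" "\<theta> 0 = x"
    using torus_solution_exists by blast
  have \<theta>k: "\<theta> (2 * pi * real k) = x + 2 * pi * of_int r * k" for k
  proof (induction k)
    case (Suc k)
    with poincare_fixed_imp_periodic[OF \<theta>(1), of r "2 * pi * real k"] assms \<theta>(2) show ?case
      by (simp add: algebra_simps)
  qed (simp add: \<theta>)
  have "(\<lambda>k. x / (2 * pi) * inverse (real k) + of_int r) \<longlonglongrightarrow> x / (2 * pi) * 0 + of_int r"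
    by (intro tendsto_intros lim_inverse_n)
  then have "(\<lambda>k. x / (2 * pi) * inverse (real k) + of_int r) \<longlonglongrightarrow> of_int r" by simp
  then have "(\<lambda>k::nat. \<theta> (2 * pi * real k) / (2 * pi * real k)) \<longlonglongrightarrow> of_int r"
  proof (rule Lim_transform_eventually[OF _ eventually_sequentiallyI[of 1]])
    fix k :: nat assume "k \<ge> 1"
    then show "x / (2 * pi) * inverse (real k) + of_int r = \<theta> (2 * pi * real k) / (2 * pi * real k)"
      unfolding \<theta>k by (simp add: field_simps)
  qed
  moreover have "(\<lambda>k::nat. \<theta> (2 * pi * real k) / (2 * pi * real k)) \<longlonglongrightarrow> rotation_number B A \<omega>"
    using \<theta> by (intro rotation_number_limit) (simp add: josephson_solution_def)
  ultimately show ?thesis using LIMSEQ_unique by blast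
qed

text \<open>Without a fixed point the displacement relative to \<open>2 * pi * r\<close> has
  constant sign and, being periodic, stays at distance at least \<open>e > 0\<close> from
  \<open>0\<close>. The gain adds up over the periods and moves the rotation number away from
  \<open>r\<close> by at least \<open>e / (2 * pi)\<close>.\<close>

lemma rotation_number_imp_poincare_fixed:
  assumes "rotation_number B A \<omega> = of_int r"
  shows "\<exists>x. poincare (1 / \<omega>) (B / \<omega>) (A / \<omega>) x = x + 2 * pi * of_int r"
proof (rule ccontr)
  assume no_fixed: "\<not> ?thesis"
  let ?P = "poincare (1 / \<omega>) (B / \<omega>) (A / \<omega>)"
  define Q where "Q x = ?P x - x - 2 * pi * of_int r" for x
  have Q_ne: "Q x \<noteq> 0" for x using no_fixed by (auto simp: Q_def algebra_simps)
  have contQ: "continuous_on S Q" for S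
    unfolding Q_def by (intro continuous_intros continuous_on_poincare)
  then have "isCont Q x" for x using contQ[of UNIV] continuous_on_eq_continuous_at[OF open_UNIV] by blast
  then have "(\<forall>x. Q x > 0) \<or> (\<forall>x. Q x < 0)"
    using isCont_attains_between[of Q _ 0] Q_ne by (meson linorder_neqE_linordered_idom order_less_imp_le)
  \<comment> \<open>The sign \<open>\<sigma>\<close> treats upward and downward drift
    together.\<close>
  then obtain \<sigma> :: real where \<sigma>: "\<sigma> = 1 \<or> \<sigma> = -1" "\<And>x. \<sigma> * Q x > 0"
    by (metis mult_1 mult_minus1 neg_0_less_iff_less)
  have "\<exists>x\<in>{0..2 * pi}. \<forall>y\<in>{0..2 * pi}. \<sigma> * Q x \<le> \<sigma> * Q y"
    by (intro continuous_attains_inf continuous_intros contQ) auto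
  then obtain e where e: "e > 0" "\<And>y. y \<in> {0..2 * pi} \<Longrightarrow> e \<le> \<sigma> * Q y"
    using \<sigma>(2) by blast
  have e_le: "e \<le> \<sigma> * Q y" for y
  proof -
    define n where "n = \<lfloor>y / (2 * pi)\<rfloor>"
    define z where "z = y - 2 * pi * of_int n"
    have "of_int n \<le> y / (2 * pi)" "y / (2 * pi) < of_int n + 1" unfolding n_def by linarith+
    then have "z \<in> {0..2 * pi}" by (auto simp: z_def field_simps)
    moreover have "Q y = Q z"
      using poincare_add_period[of "1 / \<omega>" "B / \<omega>" "A / \<omega>" z n] by (simp add: Q_def z_def)
    ultimately show ?thesis using e(2) by simp
  qed
  obtain \<theta> where \<theta>: "torus_solution (1 / \<omega>) (B / \<omega>) (A / \<omega>) \<theta>" "\<theta> 0 = 0"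
    using torus_solution_exists by blast
  have step: "\<theta> (2 * pi * real (Suc k)) = ?P (\<theta> (2 * pi * real k))" for k
    using poincare_eq[OF torus_solution_shift_time[OF \<theta>(1), of k]] by (simp add: algebra_simps)
  have growth: "\<sigma> * (\<theta> (2 * pi * real k) - 2 * pi * of_int r * k) \<ge> k * e" for k
  proof (induction k)
    case (Suc k)
    have "\<sigma> * (\<theta> (2 * pi * real (Suc k)) - 2 * pi * of_int r * Suc k)
      = \<sigma> * (\<theta> (2 * pi * real k) - 2 * pi * of_int r * k) + \<sigma> * Q (\<theta> (2 * pi * real k))"
      unfolding step Q_def by (simp add: algebra_simps)
    with Suc e_le[of "\<theta> (2 * pi * real k)"] show ?case by (simp add: algebra_simps)
  qed (simp add: \<theta>)
  have lim: "(\<lambda>k::nat. \<sigma> * (\<theta> (2 * pi * real k) / (2 * pi * real k) - of_int r)) \<longlonglongrightarrow> \<sigma> * (of_int r - of_int r)"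
    using rotation_number_limit[of B A \<omega> \<theta>] \<theta> assms
    by (intro tendsto_intros) (simp add: josephson_solution_def)
  have "e / (2 * pi) \<le> \<sigma> * (of_int r - of_int r)"
  proof (rule tendsto_lowerbound[OF lim eventually_sequentiallyI[of 1]])
    fix k :: nat assume k: "k \<ge> 1"
    have "\<sigma> * (\<theta> (2 * pi * real k) / (2 * pi * real k) - of_int r)
        = \<sigma> * (\<theta> (2 * pi * real k) - 2 * pi * of_int r * k) / (2 * pi * real k)"
      using k by (simp add: field_simps)
    also have "\<dots> \<ge> k * e / (2 * pi * k)" by (intro divide_right_mono growth) auto
    also have "k * e / (2 * pi * k) = e / (2 * pi)" using k by simp
    finally show "e / (2 * pi) \<le> \<sigma> * (\<theta> (2 * pi * real k) / (2 * pi * real k) - of_int r)" .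
  qed simp
  moreover have "e / (2 * pi) > 0" using e pi_gt_zero by (intro divide_pos_pos) auto
  ultimately show False by simp
qed

section \<open>Interior of the phase-lock area\<close>

text \<open>
  A Moebius map with the fixed points \<open>p\<close> and \<open>- p\<close> moves the two arcs between them in opposite directions, and the
  arcs contain \<open>0\<close> and \<open>pi\<close>.
\<close>

lemma poincare_fixed_imp_opposite:
  assumes fixed: "poincare a l s x = x + 2 * pi * of_int r"
  defines "\<alpha> \<equiv> poincare a l s 0 - 2 * pi * of_int r"
    and "\<beta> \<equiv> poincare a l s pi - pi - 2 * pi * of_int r"
  shows "\<not> (\<alpha> > 0 \<and> \<beta> > 0)" "\<not> (\<alpha> < 0 \<and> \<beta> < 0)"
proof -
  \<comment> \<open>Rounding to the nearest multiple of \<open>2 * pi\<close> brings the fixed point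
    into \<open>[- pi, pi]\<close>; the symmetry then allows its absolute value to be used.\<close>
  define n where "n = round (x / (2 * pi))"
  define z where "z = x - 2 * pi * of_int n"
  have n: "of_int n \<le> x / (2 * pi) + 1 / 2" "x / (2 * pi) < of_int n + 1 / 2"
    unfolding n_def round_def by linarith+
  have z: "\<bar>z\<bar> \<le> pi"
    using n by (auto simp: z_def field_simps abs_le_iff)
  have "poincare a l s z = z + 2 * pi * of_int r"
    using poincare_add_period[of a l s z n] fixed by (simp add: z_def)
  from this poincare_fixed_uminus[OF this]
  have p_fixed: "poincare a l s \<bar>z\<bar> = \<bar>z\<bar> + 2 * pi * of_int r"
    by (cases "z \<ge> 0") simp_all
  define p where "p = \<bar>z\<bar>"
  have "\<not> (\<alpha> > 0 \<and> \<beta> > 0) \<and> \<not> (\<alpha> < 0 \<and> \<beta> < 0)"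
  proof (cases "p = 0 \<or> p = pi")
    case True
    then have "\<alpha> = 0 \<or> \<beta> = 0" using p_fixed by (auto simp: p_def \<alpha>_def \<beta>_def)
    then show ?thesis by auto
  next
    case False
    then have p: "0 < p" "p < pi" using z by (auto simp: p_def)
    obtain \<theta> where \<theta>: "torus_solution a l s \<theta>" "\<theta> 0 = p" "\<theta> (2 * pi) = p + 2 * pi * of_int r"
      using p_fixed unfolding p_def[symmetric] by (metis poincare_solution)
    obtain \<eta> where \<eta>: "torus_solution a l s \<eta>" "\<eta> 0 = - p" "\<eta> (2 * pi) = - p + 2 * pi * of_int r"
      using poincare_fixed_uminus[OF p_fixed] unfolding p_def[symmetric] by (metis poincare_solution)
    obtain \<xi> where \<xi>: "torus_solution a l s \<xi>" "\<xi> 0 = 0" "\<xi> (2 * pi) = \<alpha> + 2 * pi * of_int r"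
      by (rule poincare_solution[of a l s 0]) (auto simp: \<alpha>_def)
    obtain \<zeta> where \<zeta>: "torus_solution a l s \<zeta>" "\<zeta> 0 = pi" "\<zeta> (2 * pi) = pi + \<beta> + 2 * pi * of_int r"
      by (rule poincare_solution[of a l s pi]) (auto simp: \<beta>_def)
    define m1 m2 m3 m4 where "m1 = multiplier a \<theta> (2 * pi)" and "m2 = multiplier a \<eta> (2 * pi)"
      and "m3 = multiplier a \<xi> (2 * pi)" and "m4 = multiplier a \<zeta> (2 * pi)"
    have m: "m1 > 0" "m2 > 0" "m3 > 0" "m4 > 0"
      by (simp_all add: m1_def m2_def m3_def m4_def multiplier_pos)
    \<comment> \<open>The images of \<open>0\<close> and \<open>pi\<close> stay between neighbouring
      fixed points. So \<open>\<alpha> / 2\<close> and \<open>\<beta> / 2\<close> are small enough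
      for their sines to have the signs of \<open>\<alpha>\<close> and
      \<open>\<beta>\<close>.\<close>
    have \<alpha>: "\<bar>\<alpha>\<bar> < p"
      using torus_solution_diff_between(1)[OF \<theta>(1) \<xi>(1), of "2 * pi"]
        torus_solution_diff_between(1)[OF \<xi>(1) \<eta>(1), of "2 * pi"] p \<theta> \<eta> \<xi> by auto
    have \<beta>: "\<bar>\<beta>\<bar> < pi - p"
      using torus_solution_diff_between(1)[OF \<zeta>(1) \<theta>(1), of "2 * pi"]
        torus_solution_diff_between(2)[OF \<zeta>(1) \<eta>(1), of "2 * pi"] p \<theta> \<eta> \<zeta> by auto
    \<comment> \<open>The chordal identity for \<open>\<xi>\<close> against both fixed solutions,
      subtracted, gives \<open>\<alpha>\<close> the sign of \<open>m2 - m1\<close>. The same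
      computation for \<open>\<zeta>\<close> gives \<open>\<beta>\<close> the sign of
      \<open>m1 - m2\<close>.\<close>
    have "sin ((p - \<alpha>) / 2) = sin (p / 2) * m1 * m3"
      using sin_half_diff_torus_solutions[OF \<theta>(1) \<xi>(1), of "2 * pi"] \<theta> \<xi> by (simp add: m1_def m3_def)
    moreover have "sin ((\<alpha> + p) / 2) = sin (p / 2) * m3 * m2"
      using sin_half_diff_torus_solutions[OF \<xi>(1) \<eta>(1), of "2 * pi"] \<eta> \<xi> by (simp add: m2_def m3_def)
    moreover have "sin ((\<alpha> + p) / 2) - sin ((p - \<alpha>) / 2) = 2 * cos (p / 2) * sin (\<alpha> / 2)"
      by (simp add: add_divide_distrib diff_divide_distrib sin_add sin_diff)
    ultimately have A: "sin (p / 2) * m3 * (m2 - m1) = 2 * cos (p / 2) * sin (\<alpha> / 2)"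
      by (simp add: algebra_simps)
    have "sin ((pi + \<beta> - p) / 2) = sin ((pi - p) / 2) * m4 * m1"
      using sin_half_diff_torus_solutions[OF \<zeta>(1) \<theta>(1), of "2 * pi"] \<theta> \<zeta> by (simp add: m1_def m4_def)
    moreover have "sin ((pi + \<beta> + p) / 2) = sin ((pi + p) / 2) * m4 * m2"
      using sin_half_diff_torus_solutions[OF \<zeta>(1) \<eta>(1), of "2 * pi"] \<eta> \<zeta> by (simp add: m2_def m4_def add.assoc)
    moreover have "sin ((pi + \<beta> - p) / 2) - sin ((pi + \<beta> + p) / 2) = 2 * sin (p / 2) * sin (\<beta> / 2)"
      by (simp add: add_divide_distrib diff_divide_distrib sin_add sin_diff cos_add)
    moreover have "sin ((pi - p) / 2) = cos (p / 2)" "sin ((pi + p) / 2) = cos (p / 2)"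
      by (simp_all add: add_divide_distrib diff_divide_distrib sin_add sin_diff)
    ultimately have B: "cos (p / 2) * m4 * (m1 - m2) = 2 * sin (p / 2) * sin (\<beta> / 2)"
      by (simp add: algebra_simps)
    have pos: "sin (p / 2) > 0" "cos (p / 2) > 0"
      using p by (auto intro!: sin_gt_zero cos_gt_zero)
    show ?thesis
    proof (cases "m1 \<le> m2")
      case True
      then have "sin (p / 2) * m3 * (m2 - m1) \<ge> 0" "cos (p / 2) * m4 * (m1 - m2) \<le> 0"
        using pos m by (simp_all add: mult_nonneg_nonpos)
      then have "sin (\<alpha> / 2) \<ge> 0" "sin (\<beta> / 2) \<le> 0"
        unfolding A B using pos by (simp_all add: zero_le_mult_iff mult_le_0_iff)
      moreover have "sin (- \<alpha> / 2) > 0" if "\<alpha> < 0"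
        using that \<alpha> p by (intro sin_gt_zero) auto
      moreover have "sin (\<beta> / 2) > 0" if "\<beta> > 0"
        using that \<beta> p by (intro sin_gt_zero) auto
      ultimately show ?thesis by auto
    next
      case False
      then have "sin (p / 2) * m3 * (m2 - m1) \<le> 0" "cos (p / 2) * m4 * (m1 - m2) \<ge> 0"
        using pos m by (simp_all add: mult_nonneg_nonpos)
      then have "sin (\<alpha> / 2) \<le> 0" "sin (\<beta> / 2) \<ge> 0"
        unfolding A B using pos by (simp_all add: zero_le_mult_iff mult_le_0_iff)
      moreover have "sin (\<alpha> / 2) > 0" if "\<alpha> > 0"
        using that \<alpha> p by (intro sin_gt_zero) auto
      moreover have "sin (- \<beta> / 2) > 0" if "\<beta> < 0"
        using that \<beta> p by (intro sin_gt_zero) auto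
      ultimately show ?thesis by auto
    qed
  qed
  then show "\<not> (\<alpha> > 0 \<and> \<beta> > 0)" "\<not> (\<alpha> < 0 \<and> \<beta> < 0)" by blast+
qed

section \<open>The two zones that make up the interior\<close>

definition josephson_poincare :: "real \<Rightarrow> real \<times> real \<times> real \<Rightarrow> real" where
  "josephson_poincare x = (\<lambda>(B, A, \<omega>). poincare (1 / \<omega>) (B / \<omega>) (A / \<omega>) x)"

definition upper_zone :: "int \<Rightarrow> (real \<times> real \<times> real) set" where
  "upper_zone r = {p. snd (snd p) > 0 \<and> josephson_poincare 0 p > 2 * pi * of_int r
     \<and> josephson_poincare pi p < pi + 2 * pi * of_int r}"

definition lower_zone :: "int \<Rightarrow> (real \<times> real \<times> real) set" where
  "lower_zone r = {p. snd (snd p) > 0 \<and> josephson_poincare 0 p < 2 * pi * of_int r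
     \<and> josephson_poincare pi p > pi + 2 * pi * of_int r}"

lemma open_zones: "open (upper_zone r)" "open (lower_zone r)"
proof -
  define U where "U = {p :: real \<times> real \<times> real. snd (snd p) > 0}"
  have U: "open U" unfolding U_def by (intro open_Collect_less continuous_intros)
  have cont: "continuous_on U (josephson_poincare x)" for x
    unfolding josephson_poincare_def split_beta U_def
    by (intro continuous_on_poincare continuous_intros) auto
  have open_vimage: "open (U \<inter> josephson_poincare x -` T)" if "open T" for x T
    by (rule continuous_open_preimage[OF cont U that])
  have "upper_zone r = (U \<inter> josephson_poincare 0 -` {2 * pi * of_int r<..})
      \<inter> (U \<inter> josephson_poincare pi -` {..<pi + 2 * pi * of_int r})"
    by (auto simp: upper_zone_def U_def)
  then show "open (upper_zone r)" by (simp add: open_Int open_vimage)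
  have "lower_zone r = (U \<inter> josephson_poincare 0 -` {..<2 * pi * of_int r})
      \<inter> (U \<inter> josephson_poincare pi -` {pi + 2 * pi * of_int r<..})"
    by (auto simp: lower_zone_def U_def)
  then show "open (lower_zone r)" by (simp add: open_Int open_vimage)
qed

text \<open>The displacements of \<open>0\<close> and \<open>pi\<close> lie on the two sides of
  \<open>2 * pi * r\<close>, so some point in between is moved by exactly that amount.\<close>

lemma zones_subset_phase_lock_area:
  "upper_zone r \<subseteq> phase_lock_area (of_int r)" "lower_zone r \<subseteq> phase_lock_area (of_int r)"
proof -
  have zero: "rotation_number B A \<omega> = of_int r"
    if "josephson_poincare u (B, A, \<omega>) - u \<le> 2 * pi * of_int r"
      "2 * pi * of_int r \<le> josephson_poincare v (B, A, \<omega>) - v" for B A \<omega> u v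
  proof -
    have "continuous_on UNIV (\<lambda>x. josephson_poincare x (B, A, \<omega>) - x)"
      unfolding josephson_poincare_def by (simp, intro continuous_intros continuous_on_poincare)
    then have "\<exists>x. josephson_poincare x (B, A, \<omega>) - x = 2 * pi * of_int r"
      using that continuous_on_eq_continuous_at[OF open_UNIV]
      by (intro isCont_attains_between[of _ u _ v]) blast+
    then obtain x where "josephson_poincare x (B, A, \<omega>) - x = 2 * pi * of_int r" ..
    then show ?thesis
      by (intro poincare_fixed_imp_rotation_number[of _ _ _ x]) (simp add: josephson_poincare_def algebra_simps)
  qed
  show "upper_zone r \<subseteq> phase_lock_area (of_int r)"
  proof
    fix p assume "p \<in> upper_zone r"
    then show "p \<in> phase_lock_area (of_int r)"
      using zero[of pi "fst p" "fst (snd p)" "snd (snd p)" 0]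
      by (auto simp: upper_zone_def phase_lock_area_def split_beta)
  qed
  show "lower_zone r \<subseteq> phase_lock_area (of_int r)"
  proof
    fix p assume "p \<in> lower_zone r"
    then show "p \<in> phase_lock_area (of_int r)"
      using zero[of 0 "fst p" "fst (snd p)" "snd (snd p)" pi]
      by (auto simp: lower_zone_def phase_lock_area_def split_beta)
  qed
qed

lemma josephson_poincare_strict_mono:
  assumes "B < B'" "\<omega> > 0"
  shows "josephson_poincare x (B, A, \<omega>) < josephson_poincare x (B', A, \<omega>)"
  using assms by (simp add: josephson_poincare_def poincare_strict_mono_l divide_strict_right_mono)

text \<open>
  Off the two zones, a change of \<open>B\<close> in a suitable direction moves \<open>0\<close> and \<open>pi\<close> strictly to the same side, which unlocks the phase.
\<close>

lemma interior_phase_lock_area: "interior (phase_lock_area (of_int r)) = upper_zone r \<union> lower_zone r"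
proof
  show "upper_zone r \<union> lower_zone r \<subseteq> interior (phase_lock_area (of_int r))"
    using zones_subset_phase_lock_area open_zones by (simp add: interior_maximal)
next
  show "interior (phase_lock_area (of_int r)) \<subseteq> upper_zone r \<union> lower_zone r"
  proof
    fix p assume p: "p \<in> interior (phase_lock_area (of_int r))"
    obtain B A \<omega> where p_eq: "p = (B, A, \<omega>)" by (cases p) auto
    have \<omega>: "\<omega> > 0" using p interior_subset by (fastforce simp: p_eq phase_lock_area_def)
    obtain e where e: "e > 0" "ball p e \<subseteq> phase_lock_area (of_int r)"
      using p by (auto simp: mem_interior)
    have mem: "(B + d, A, \<omega>) \<in> phase_lock_area (of_int r)" if "\<bar>d\<bar> < e" for d
      using e that by (auto simp: p_eq dist_Pair_Pair dist_real_def intro!: subsetD[OF e(2)])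
    have opp: "\<not> (josephson_poincare 0 (B + d, A, \<omega>) > 2 * pi * of_int r
          \<and> josephson_poincare pi (B + d, A, \<omega>) > pi + 2 * pi * of_int r)"
      "\<not> (josephson_poincare 0 (B + d, A, \<omega>) < 2 * pi * of_int r
          \<and> josephson_poincare pi (B + d, A, \<omega>) < pi + 2 * pi * of_int r)" if d: "\<bar>d\<bar> < e" for d
    proof -
      have "rotation_number (B + d) A \<omega> = of_int r"
        using mem[OF d] by (simp add: phase_lock_area_def)
      then obtain x where "poincare (1 / \<omega>) ((B + d) / \<omega>) (A / \<omega>) x = x + 2 * pi * of_int r"
        using rotation_number_imp_poincare_fixed by blast
      from poincare_fixed_imp_opposite[OF this]
      show "\<not> (josephson_poincare 0 (B + d, A, \<omega>) > 2 * pi * of_int r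
          \<and> josephson_poincare pi (B + d, A, \<omega>) > pi + 2 * pi * of_int r)"
        "\<not> (josephson_poincare 0 (B + d, A, \<omega>) < 2 * pi * of_int r
          \<and> josephson_poincare pi (B + d, A, \<omega>) < pi + 2 * pi * of_int r)"
        by (auto simp: josephson_poincare_def)
    qed
    \<comment> \<open>Raising \<open>B\<close> rules out that \<open>0\<close> and \<open>pi\<close>
      both move weakly up, lowering it that both move weakly down. What remains is strict motion in
      opposite directions.\<close>
    have mono: "josephson_poincare x (B, A, \<omega>) < josephson_poincare x (B + e / 2, A, \<omega>)"
      "josephson_poincare x (B + - (e / 2), A, \<omega>) < josephson_poincare x (B, A, \<omega>)" for x
      using e \<omega> by (intro josephson_poincare_strict_mono; simp)+
    show "p \<in> upper_zone r \<union> lower_zone r"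
      using opp[of "e / 2"] opp[of "- (e / 2)"] mono[of 0] mono[of pi] e(1) \<omega>
      unfolding p_eq upper_zone_def lower_zone_def by auto
  qed
qed

section \<open>Oscillation of Bessel functions\<close>

definition oscillates :: "(real \<Rightarrow> real) \<Rightarrow> bool" where
  "oscillates f \<longleftrightarrow> (\<forall>c. (\<exists>s>c. f s > 0) \<and> (\<exists>s>c. f s < 0))"

lemma oscillates_sgn_cong:
  assumes "oscillates f" "\<And>s. s > 0 \<Longrightarrow> sgn (g s) = sgn (f s)"
  shows "oscillates g"
  unfolding oscillates_def
proof (intro allI conjI)
  fix c :: real
  obtain s t where "s > max c 0" "f s > 0" "t > max c 0" "f t < 0"
    using assms(1) unfolding oscillates_def by metis
  with assms(2)[of s] assms(2)[of t] show "\<exists>s>c. g s > 0" "\<exists>s>c. g s < 0"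
    by (auto simp: sgn_if split: if_splits)
qed

lemma oscillates_uminus: "oscillates f \<Longrightarrow> oscillates (\<lambda>s. - f s)"
  by (auto simp: oscillates_def)

text \<open>The mean value theorem between consecutive sign changes; this carries oscillation from
  one Bessel order to its neighbours.\<close>

lemma oscillates_derivative:
  assumes g: "\<And>s. s > 0 \<Longrightarrow> (g has_real_derivative g' s) (at s)" and osc: "oscillates g"
  shows "oscillates g'"
  unfolding oscillates_def
proof (intro allI conjI)
  fix c :: real
  obtain s where s: "s > max c 0" "g s > 0" using osc unfolding oscillates_def by metis
  obtain t where t: "t > s" "g t < 0" using osc unfolding oscillates_def by metis
  obtain u where u: "u > t" "g u > 0" using osc unfolding oscillates_def by metis
  obtain z where z: "s < z" "z < t" "g t - g s = (t - s) * g' z"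
    using MVT2[of s t g g'] s t g by auto
  have "g' z < 0"
    using z s t by (metis diff_gt_0_iff_gt diff_less_0_iff_less less_trans mult_less_0_iff not_less_iff_gr_or_eq)
  then show "\<exists>s>c. g' s < 0" using z s by (intro exI[of _ z]) auto
  obtain z where z: "t < z" "z < u" "g u - g t = (u - t) * g' z"
    using MVT2[of t u g g'] s t u g by auto
  have "g' z > 0"
    using z t u by (metis diff_gt_0_iff_gt less_trans zero_less_mult_pos)
  then show "\<exists>s>c. g' s > 0" using z s t by (intro exI[of _ z]) auto
qed

text \<open>Up to the factor \<open>2 * pi\<close>, this is the Bessel function of the first kind of order \<open>- n\<close>.\<close>

definition bessel_integral :: "int \<Rightarrow> real \<Rightarrow> real" where
  "bessel_integral n s = integral {0..2 * pi} (\<lambda>t. cos (of_int n * t + s * sin t))"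

section \<open>Derivative and recurrence formulas for Bessel integrals\<close>

lemma bessel_integral_integrable:
  "(\<lambda>t. cos (of_int n * t + s * sin t)) integrable_on {0..2 * pi}"
  by (intro integrable_continuous_real continuous_intros)

lemma bessel_integral_has_integral:
  "((\<lambda>t. cos (of_int n * t + s * sin t)) has_integral bessel_integral n s) {0..2 * pi}"
  unfolding bessel_integral_def by (rule integrable_integral[OF bessel_integral_integrable])

text \<open>Differentiation under the integral sign produces a product of two sines, which is half a
  difference of cosines of the neighbouring orders.\<close>

lemma bessel_integral_has_derivative_diff:
  "(bessel_integral n has_real_derivative (bessel_integral (n + 1) s - bessel_integral (n - 1) s) / 2) (at s)"
proof -
  have "((\<lambda>s. integral (cbox 0 (2 * pi)) (\<lambda>t. cos (of_int n * t + s * sin t))) has_real_derivative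
      integral (cbox 0 (2 * pi)) (\<lambda>t. - sin (of_int n * t + s * sin t) * sin t)) (at s within UNIV)"
  proof (rule leibniz_rule_field_derivative)
    show "continuous_on (UNIV \<times> cbox 0 (2 * pi)) (\<lambda>(x, t). - sin (of_int n * t + x * sin t) * sin t)"
      unfolding split_beta by (intro continuous_intros)
  qed (auto intro!: derivative_eq_intros integrable_continuous_real continuous_intros)
  then have deriv: "(bessel_integral n has_real_derivative
      integral {0..2 * pi} (\<lambda>t. - sin (of_int n * t + s * sin t) * sin t)) (at s)"
    by (simp flip: bessel_integral_def)
  have "((\<lambda>t. (cos (of_int (n + 1) * t + s * sin t) - cos (of_int (n - 1) * t + s * sin t)) / 2)
      has_integral (bessel_integral (n + 1) s - bessel_integral (n - 1) s) / 2) {0..2 * pi}"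
    by (intro has_integral_divide has_integral_diff bessel_integral_has_integral)
  moreover have "(cos (of_int (n + 1) * t + s * sin t) - cos (of_int (n - 1) * t + s * sin t)) / 2
      = - sin (of_int n * t + s * sin t) * sin t" for t
  proof -
    have "of_int (n + 1) * t + s * sin t = (of_int n * t + s * sin t) + t"
      "of_int (n - 1) * t + s * sin t = (of_int n * t + s * sin t) - t" by (simp_all add: algebra_simps)
    then show ?thesis by (simp only: cos_add cos_diff) simp
  qed
  ultimately have "integral {0..2 * pi} (\<lambda>t. - sin (of_int n * t + s * sin t) * sin t)
      = (bessel_integral (n + 1) s - bessel_integral (n - 1) s) / 2"
    by (simp only: integral_unique)
  with deriv show ?thesis by (simp only:)
qed

text \<open>The function \<open>sin (n * t + s * sin t)\<close> vanishes at both ends of the period,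
  so its derivative \<open>(n + s * cos t) * cos (n * t + s * sin t)\<close> integrates to
  \<open>0\<close>.\<close>

lemma bessel_integral_recurrence:
  "of_int n * bessel_integral n s + s / 2 * (bessel_integral (n + 1) s + bessel_integral (n - 1) s) = 0"
proof -
  have "((\<lambda>t. (of_int n + s * cos t) * cos (of_int n * t + s * sin t)) has_integral
      (sin (of_int n * (2 * pi) + s * sin (2 * pi)) - sin (of_int n * 0 + s * sin 0))) {0..2 * pi}"
    by (rule fundamental_theorem_of_calculus)
      (auto intro!: derivative_eq_intros simp: has_real_derivative_iff_has_vector_derivative[symmetric] algebra_simps)
  moreover have "sin (of_int n * (2 * pi)) = (0 :: real)"
    by (metis mult.commute sin_int_2pin)
  ultimately have zero: "((\<lambda>t. (of_int n + s * cos t) * cos (of_int n * t + s * sin t)) has_integral 0) {0..2 * pi}"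
    by simp
  have "((\<lambda>t. of_int n * cos (of_int n * t + s * sin t)
      + s / 2 * (cos (of_int (n + 1) * t + s * sin t) + cos (of_int (n - 1) * t + s * sin t))) has_integral
      (of_int n * bessel_integral n s + s / 2 * (bessel_integral (n + 1) s + bessel_integral (n - 1) s))) {0..2 * pi}"
    by (intro has_integral_add has_integral_mult_right bessel_integral_has_integral)
  moreover have "of_int n * cos (of_int n * t + s * sin t)
      + s / 2 * (cos (of_int (n + 1) * t + s * sin t) + cos (of_int (n - 1) * t + s * sin t))
      = (of_int n + s * cos t) * cos (of_int n * t + s * sin t)" for t
  proof -
    have "of_int (n + 1) * t + s * sin t = (of_int n * t + s * sin t) + t"
      "of_int (n - 1) * t + s * sin t = (of_int n * t + s * sin t) - t" by (simp_all add: algebra_simps)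
    then show ?thesis by (simp only: cos_add cos_diff) (simp add: algebra_simps)
  qed
  ultimately have "((\<lambda>t. (of_int n + s * cos t) * cos (of_int n * t + s * sin t)) has_integral
      (of_int n * bessel_integral n s + s / 2 * (bessel_integral (n + 1) s + bessel_integral (n - 1) s))) {0..2 * pi}"
    by (simp only:)
  then show ?thesis using zero by (rule has_integral_unique)
qed

lemma bessel_integral_has_derivative:
  assumes "s > 0"
  shows "(bessel_integral n has_real_derivative bessel_integral (n + 1) s + of_int n * bessel_integral n s / s) (at s)"
    and "(bessel_integral n has_real_derivative - bessel_integral (n - 1) s - of_int n * bessel_integral n s / s) (at s)"
proof -
  have "(bessel_integral (n + 1) s - bessel_integral (n - 1) s) / 2
      = bessel_integral (n + 1) s + of_int n * bessel_integral n s / s"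
    "(bessel_integral (n + 1) s - bessel_integral (n - 1) s) / 2
      = - bessel_integral (n - 1) s - of_int n * bessel_integral n s / s"
    using bessel_integral_recurrence[of n s] assms by (simp_all add: field_simps)
  note eqs = this
  show "(bessel_integral n has_real_derivative bessel_integral (n + 1) s + of_int n * bessel_integral n s / s) (at s)"
    "(bessel_integral n has_real_derivative - bessel_integral (n - 1) s - of_int n * bessel_integral n s / s) (at s)"
    by (simp_all only: bessel_integral_has_derivative_diff flip: eqs)
qed

text \<open>This is the Bessel equation of order zero as a first-order system. If \<open>y\<close>
  stayed nonnegative, \<open>s * y1 s\<close> would not increase. A negative value of
  \<open>y1\<close> would then push \<open>y\<close> down at least logarithmically; otherwise
  \<open>y\<close> is nondecreasing and eventually positive, so \<open>s * y1 s\<close> falls at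
  least linearly and becomes negative after all.\<close>

lemma bessel_equation_eventually_negative:
  fixes y y1 :: "real \<Rightarrow> real"
  assumes y: "\<And>s. s > 0 \<Longrightarrow> (y has_real_derivative y1 s) (at s)"
    and y1: "\<And>s. s > 0 \<Longrightarrow> ((\<lambda>s. s * y1 s) has_real_derivative - s * y s) (at s)"
    and nontriv: "\<And>s. s > 0 \<Longrightarrow> y s \<noteq> 0 \<or> y1 s \<noteq> 0"
  shows "\<exists>s>c. y s < 0"
proof (rule ccontr)
  assume none: "\<not> (\<exists>s>c. y s < 0)"
  define d where "d = max c 0 + 1"
  have d: "d > 0" by (auto simp: d_def)
  have nonneg: "y s \<ge> 0" if "s \<ge> d" for s
    using none that by (force simp: d_def not_less)
  have y1_nonneg: "y1 s \<ge> 0" if s: "s \<ge> d" for s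
  proof (rule ccontr)
    assume neg: "\<not> y1 s \<ge> 0"
    define k where "k = - (s * y1 s)"
    have k: "k > 0" using neg s d by (simp add: k_def mult_pos_neg)
    have le: "t * y1 t \<le> - k" if "t \<ge> s" for t
      unfolding k_def minus_minus
    proof (rule DERIV_nonpos_imp_nonincreasing[OF that])
      fix u assume "s \<le> u"
      with s d nonneg[of u] y1[of u]
      show "\<exists>z. ((\<lambda>s. s * y1 s) has_real_derivative z) (at u) \<and> z \<le> 0"
        by (intro exI[of _ "- u * y u"]) (auto simp: mult_nonneg_nonneg)
    qed
    \<comment> \<open>Chosen so that \<open>k * ln t\<close> exceeds \<open>k * ln s\<close> by
      \<open>y s + 1\<close>, which forces \<open>y t \<le> - 1\<close>.\<close>
    define t where "t = s * exp ((y s + 1) / k)"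
    have "t \<ge> s * 1"
      unfolding t_def using s d k nonneg[OF s] by (intro mult_left_mono) auto
    then have t: "t \<ge> s" by simp
    have "y t + k * ln t \<le> y s + k * ln s"
    proof (rule DERIV_nonpos_imp_nonincreasing[OF t])
      fix u assume u: "s \<le> u"
      have "((\<lambda>t. y t + k * ln t) has_real_derivative y1 u + k / u) (at u)"
        using u s d by (auto intro!: derivative_eq_intros y)
      moreover have "y1 u + k / u \<le> 0" using le[OF u] u s d by (simp add: field_simps)
      ultimately show "\<exists>z. ((\<lambda>t. y t + k * ln t) has_real_derivative z) (at u) \<and> z \<le> 0" by blast
    qed
    moreover have "k * ln t = k * ln s + y s + 1"
      using s d k by (simp add: t_def ln_mult distrib_left) (simp add: field_simps)
    ultimately show False using nonneg[of t] s t by simp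
  qed
  have "\<exists>s\<ge>d. y s > 0"
  proof (cases "y d = 0")
    case True
    then have "y1 d > 0" using nontriv[OF d] y1_nonneg[of d] by simp
    from DERIV_pos_inc_right[OF y[OF d] this] obtain h where "h > 0" "\<And>k. 0 < k \<Longrightarrow> k < h \<Longrightarrow> y d < y (d + k)"
      by blast
    then show ?thesis using True by (intro exI[of _ "d + h / 2"]) auto
  qed (use nonneg[of d] in force)
  then obtain s where s: "s \<ge> d" "y s > 0" by blast
  have y_ge: "y t \<ge> y s" if "t \<ge> s" for t
  proof (rule DERIV_nonneg_imp_nondecreasing[OF that])
    fix u assume "s \<le> u"
    with s d y[of u] y1_nonneg[of u] show "\<exists>z. (y has_real_derivative z) (at u) \<and> 0 \<le> z"
      by (intro exI[of _ "y1 u"]) auto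
  qed
  \<comment> \<open>Chosen so that the linear decrease reaches
    \<open>t * y1 t \<le> - 1\<close>.\<close>
  define t where "t = s + (s * y1 s + 1) / (s * y s)"
  have sy: "s * y s > 0" "s * y1 s \<ge> 0" using s d y1_nonneg[of s] by auto
  then have t: "t \<ge> s" by (simp add: t_def)
  have "t * y1 t + s * y s * t \<le> s * y1 s + s * y s * s"
  proof (rule DERIV_nonpos_imp_nonincreasing[OF t])
    fix u assume u: "s \<le> u"
    have "((\<lambda>t. t * y1 t + s * y s * t) has_real_derivative - u * y u + s * y s) (at u)"
      using u s d by (intro DERIV_add[OF y1 DERIV_cmult_Id]) simp
    moreover have "s * y s \<le> u * y u" using u s d y_ge[OF u] by (intro mult_mono) auto
    ultimately show "\<exists>z. ((\<lambda>t. t * y1 t + s * y s * t) has_real_derivative z) (at u) \<and> z \<le> 0"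
      by (intro exI[of _ "- u * y u + s * y s"]) simp
  qed
  moreover have "s * y s * t = s * y s * s + s * y1 s + 1"
    using sy by (simp add: t_def distrib_left) (use sy in \<open>force simp: add_divide_distrib\<close>)
  moreover have "t * y1 t \<ge> 0" using t s d y1_nonneg[of t] by auto
  ultimately show False by simp
qed

text \<open>The energy \<open>h\<close> has derivative
  \<open>2 * s * (bessel_integral 0 s)\<^sup>2 \<ge> 0\<close> for \<open>s > 0\<close>, and it is
  positive close to \<open>0\<close> because the integral of order zero equals \<open>2 * pi\<close>
  there.\<close>

lemma bessel_integral_0_nontrivial:
  assumes "s > 0"
  shows "bessel_integral 0 s \<noteq> 0 \<or> bessel_integral 1 s \<noteq> 0"
proof -
  define h where "h s = s\<^sup>2 * (bessel_integral 0 s)\<^sup>2 + s\<^sup>2 * (bessel_integral 1 s)\<^sup>2" for s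
  have "bessel_integral 0 0 = 2 * pi"
    by (simp add: bessel_integral_def)
  moreover have "isCont (bessel_integral 0) 0"
    by (rule DERIV_isCont[OF bessel_integral_has_derivative_diff])
  ultimately have "eventually (\<lambda>u. bessel_integral 0 u > 0) (at_right 0)"
    by (intro order_tendstoD(1)[of _ "2 * pi"]) (auto simp: isCont_def intro: filterlim_mono at_le)
  moreover have "eventually (\<lambda>u. u \<in> {0<..<s}) (at_right 0)"
    using assms by (rule eventually_at_right_real)
  ultimately have "eventually (\<lambda>u. bessel_integral 0 u > 0 \<and> u \<in> {0<..<s}) (at_right 0)"
    by (rule eventually_conj)
  then obtain u where u: "bessel_integral 0 u > 0" "0 < u" "u < s"
    using eventually_happens[of _ "at_right (0 :: real)"] by auto
  have "h u \<le> h s"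
  proof (rule DERIV_nonneg_imp_nondecreasing[of u s h])
    fix t assume "u \<le> t"
    with u have t: "t > 0" by simp
    have "(h has_real_derivative 2 * t * (bessel_integral 0 t)\<^sup>2) (at t)"
      unfolding h_def
      by (rule derivative_eq_intros bessel_integral_has_derivative(1)[of t 0] bessel_integral_has_derivative(2)[of t 1] refl t)+
        (use t in \<open>simp add: field_simps power2_eq_square\<close>)
    with t show "\<exists>y. (h has_real_derivative y) (at t) \<and> 0 \<le> y" by force
  qed (use u in simp)
  moreover have "h u > 0" using u by (simp add: h_def add_pos_nonneg)
  ultimately have "h s > 0" by simp
  then show ?thesis by (auto simp: h_def)
qed

lemma oscillates_bessel_integral_0: "oscillates (bessel_integral 0)"
  unfolding oscillates_def
proof (intro allI conjI)
  fix c :: real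
  have b0: "(bessel_integral 0 has_real_derivative bessel_integral 1 s) (at s)" if "s > 0" for s
    using bessel_integral_has_derivative(1)[OF that, of 0] by simp
  have b1: "((\<lambda>s. s * bessel_integral 1 s) has_real_derivative - s * bessel_integral 0 s) (at s)" if "s > 0" for s
    using bessel_integral_has_derivative(2)[OF that, of 1] that
    by (auto intro!: derivative_eq_intros simp: field_simps)
  show "\<exists>s>c. bessel_integral 0 s < 0"
    by (rule bessel_equation_eventually_negative[OF b0 b1 bessel_integral_0_nontrivial])
  have "\<exists>s>c. - bessel_integral 0 s < 0"
  proof (rule bessel_equation_eventually_negative)
    fix s :: real assume s: "s > 0"
    show "((\<lambda>s. - bessel_integral 0 s) has_real_derivative - bessel_integral 1 s) (at s)"
      by (rule DERIV_minus[OF b0[OF s]])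
    show "((\<lambda>s. s * - bessel_integral 1 s) has_real_derivative - s * - bessel_integral 0 s) (at s)"
      using DERIV_minus[OF b1[OF s]] by simp
    show "- bessel_integral 0 s \<noteq> 0 \<or> - bessel_integral 1 s \<noteq> 0"
      using bessel_integral_0_nontrivial[OF s] by simp
  qed
  then show "\<exists>s>c. bessel_integral 0 s > 0" by simp
qed

text \<open>Weighted by \<open>s powr (- n)\<close> or \<open>s powr n\<close>, which is positive
  for \<open>s > 0\<close>, the integral of order \<open>n\<close> has as derivative, up to sign,
  the equally weighted integral of order \<open>n + 1\<close> or \<open>n - 1\<close>.\<close>

lemma oscillates_bessel_integral_step:
  assumes "oscillates (bessel_integral n)"
  shows "oscillates (bessel_integral (n + 1))" "oscillates (bessel_integral (n - 1))"
proof -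
  have weighted: "oscillates (\<lambda>s. s powr k * bessel_integral n s)" for k
    by (rule oscillates_sgn_cong[OF assms]) (simp add: sgn_mult)
  have "((\<lambda>s. s powr (- of_int n) * bessel_integral n s) has_real_derivative
      s powr (- of_int n) * bessel_integral (n + 1) s) (at s)" if "s > 0" for s
    using that by (auto intro!: derivative_eq_intros bessel_integral_has_derivative(1) simp: algebra_simps powr_diff)
  from oscillates_derivative[OF this weighted]
  have "oscillates (\<lambda>s. s powr (- of_int n) * bessel_integral (n + 1) s)" by simp
  then show "oscillates (bessel_integral (n + 1))"
    by (rule oscillates_sgn_cong) (simp add: sgn_mult)
  have "((\<lambda>s. s powr (of_int n) * bessel_integral n s) has_real_derivative
      - (s powr (of_int n) * bessel_integral (n - 1) s)) (at s)" if "s > 0" for s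
    using that by (auto intro!: derivative_eq_intros bessel_integral_has_derivative(2) simp: algebra_simps powr_diff)
  from oscillates_uminus[OF oscillates_derivative[OF this weighted]]
  have "oscillates (\<lambda>s. s powr (of_int n) * bessel_integral (n - 1) s)" by simp
  then show "oscillates (bessel_integral (n - 1))"
    by (rule oscillates_sgn_cong) (simp add: sgn_mult)
qed

lemma oscillates_bessel_integral: "oscillates (bessel_integral n)"
proof (induction n rule: int_induct[of _ 0])
  case base
  show ?case by (rule oscillates_bessel_integral_0)
next
  case (step1 n)
  show ?case by (rule oscillates_bessel_integral_step(1)[OF step1(2)])
next
  case (step2 n)
  show ?case by (rule oscillates_bessel_integral_step(2)[OF step2(2)])
qed

section \<open>Separation of the components\<close>

text \<open>For \<open>a = 0\<close> the solution is \<open>\<psi>\<close>. The true solution stays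
  within \<open>2 * pi * a\<close> of it over one period, so replacing
  \<open>cos (\<theta> t)\<close> by \<open>cos (\<psi> t)\<close> in the integral of the speed
  costs only second order in \<open>a\<close>.\<close>

lemma poincare_small_a:
  assumes a: "a > 0"
  shows "\<bar>poincare a (of_int r) s x - (x + 2 * pi * of_int r)
    - a * integral {0..2 * pi} (\<lambda>t. cos (x + (of_int r * t + s * sin t)))\<bar> \<le> 4 * pi\<^sup>2 * a\<^sup>2"
proof -
  obtain \<theta> where \<theta>: "torus_solution a (of_int r) s \<theta>" "\<theta> 0 = x" "\<theta> (2 * pi) = poincare a (of_int r) s x"
    by (rule poincare_solution)
  define \<psi> where "\<psi> t = x + (of_int r * t + s * sin t)" for t
  define d where "d t = \<theta> t - \<psi> t" for t
  have d: "(d has_real_derivative a * cos (\<theta> t)) (at t)" for t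
    unfolding d_def \<psi>_def
    by (auto intro!: derivative_eq_intros torus_solution_has_derivative[OF \<theta>(1)])
  have d0: "d 0 = 0" by (simp add: d_def \<psi>_def \<theta>)
  have d_le: "\<bar>d t\<bar> \<le> 2 * pi * a" if t: "t \<in> {0..2 * pi}" for t
  proof (cases "t = 0")
    case False
    with t obtain z where "d t - d 0 = (t - 0) * (a * cos (\<theta> z))"
      using MVT2[of 0 t d "\<lambda>z. a * cos (\<theta> z)"] d by auto
    then have "\<bar>d t\<bar> = t * a * \<bar>cos (\<theta> z)\<bar>" using a t d0 by (simp add: abs_mult)
    also have "\<dots> \<le> 2 * pi * a * 1" using a t by (intro mult_mono) auto
    finally show ?thesis by simp
  qed (use d0 a in simp)
  have "((\<lambda>t. a * cos (\<theta> t)) has_integral (d (2 * pi) - d 0)) {0..2 * pi}"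
    by (rule fundamental_theorem_of_calculus)
      (auto intro!: has_field_derivative_at_within d simp: has_real_derivative_iff_has_vector_derivative[symmetric])
  moreover have "((\<lambda>t. cos (\<psi> t)) has_integral integral {0..2 * pi} (\<lambda>t. cos (\<psi> t))) {0..2 * pi}"
    unfolding \<psi>_def by (intro integrable_integral integrable_continuous_real continuous_intros)
  ultimately have "((\<lambda>t. a * cos (\<theta> t) - a * cos (\<psi> t)) has_integral
      (d (2 * pi) - d 0 - a * integral {0..2 * pi} (\<lambda>t. cos (\<psi> t)))) (cbox 0 (2 * pi))"
    by (auto intro!: has_integral_diff has_integral_mult_right)
  then have "norm (d (2 * pi) - d 0 - a * integral {0..2 * pi} (\<lambda>t. cos (\<psi> t)))
      \<le> (a * (2 * pi * a)) * measure lborel (cbox 0 (2 * pi))"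
  proof (rule has_integral_bound[rotated])
    fix t :: real assume t: "t \<in> cbox 0 (2 * pi)"
    have "\<bar>a * cos (\<theta> t) - a * cos (\<psi> t)\<bar> = a * \<bar>cos (\<theta> t) - cos (\<psi> t)\<bar>"
      using a by (simp add: right_diff_distrib[symmetric] abs_mult)
    also have "\<dots> \<le> a * \<bar>d t\<bar>" unfolding d_def using a by (intro mult_left_mono abs_cos_diff_le) auto
    also have "\<dots> \<le> a * (2 * pi * a)" using a t by (intro mult_left_mono d_le) auto
    finally show "norm (a * cos (\<theta> t) - a * cos (\<psi> t)) \<le> a * (2 * pi * a)" by simp
  qed (use a in auto)
  moreover have "d (2 * pi) - d 0 = poincare a (of_int r) s x - (x + 2 * pi * of_int r)"
    by (simp add: d0) (simp add: d_def \<psi>_def \<theta>)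
  ultimately show ?thesis
    by (simp add: \<psi>_def power2_eq_square mult_ac)
qed

text \<open>Adding \<open>pi\<close> flips the cosine, so to first order in \<open>a\<close> the
  points \<open>0\<close> and \<open>pi\<close> move by opposite amounts.\<close>

lemma poincare_small_a_bessel:
  assumes "a > 0"
  shows "\<bar>poincare a (of_int r) s 0 - 2 * pi * of_int r - a * bessel_integral r s\<bar> \<le> 4 * pi\<^sup>2 * a\<^sup>2"
    and "\<bar>poincare a (of_int r) s pi - pi - 2 * pi * of_int r + a * bessel_integral r s\<bar> \<le> 4 * pi\<^sup>2 * a\<^sup>2"
proof -
  have "integral {0..2 * pi} (\<lambda>t. cos (pi + (of_int r * t + s * sin t))) = - bessel_integral r s"
    by (simp add: bessel_integral_def cos_periodic_pi2)
  with poincare_small_a[OF assms, of r s pi]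
  show "\<bar>poincare a (of_int r) s pi - pi - 2 * pi * of_int r + a * bessel_integral r s\<bar> \<le> 4 * pi\<^sup>2 * a\<^sup>2"
    by (simp add: algebra_simps)
  show "\<bar>poincare a (of_int r) s 0 - 2 * pi * of_int r - a * bessel_integral r s\<bar> \<le> 4 * pi\<^sup>2 * a\<^sup>2"
    using poincare_small_a[OF assms, of r s 0] by (simp add: bessel_integral_def)
qed

text \<open>The point with \<open>l = r\<close> and given \<open>s\<close>, \<open>a\<close>,
  written in the original parameters
  \<open>(B, A, \<omega>) = (l / a, s / a, 1 / a)\<close>.\<close>

definition axis_point :: "int \<Rightarrow> real \<Rightarrow> real \<Rightarrow> real \<times> real \<times> real" where
  "axis_point r s a = (of_int r / a, s / a, 1 / a)"

lemma josephson_poincare_axis_point: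
  "a > 0 \<Longrightarrow> josephson_poincare x (axis_point r s a) = poincare a (of_int r) s x"
  by (simp add: josephson_poincare_def axis_point_def)

lemma axis_point_in_zone:
  assumes "bessel_integral r s \<noteq> 0"
  defines "Z \<equiv> if bessel_integral r s > 0 then upper_zone r else lower_zone r"
  shows "\<exists>a0>0. \<forall>a. 0 < a \<and> a \<le> a0 \<longrightarrow> axis_point r s a \<in> Z"
proof (intro exI conjI allI impI)
  define J where "J = bessel_integral r s"
  \<comment> \<open>For \<open>a \<le> a0\<close> the error
    \<open>4 * pi\<^sup>2 * a\<^sup>2\<close> is at most half of the main term
    \<open>a * \<bar>J\<bar>\<close>.\<close>
  define a0 where "a0 = \<bar>J\<bar> / (8 * pi\<^sup>2)"
  show "a0 > 0" using assms by (simp add: a0_def J_def)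
  fix a assume a: "0 < a \<and> a \<le> a0"
  have "4 * pi\<^sup>2 * a\<^sup>2 < a * \<bar>J\<bar>"
  proof -
    have "8 * pi\<^sup>2 * a \<le> \<bar>J\<bar>" using a by (simp add: a0_def field_simps)
    then have "a * (8 * pi\<^sup>2 * a) \<le> a * \<bar>J\<bar>" using a by (intro mult_left_mono) auto
    moreover have "0 < pi\<^sup>2 * a\<^sup>2" using a by simp
    ultimately show ?thesis by (simp add: power2_eq_square mult_ac)
  qed
  then have "\<bar>poincare a (of_int r) s 0 - 2 * pi * of_int r - a * J\<bar> < a * \<bar>J\<bar>"
    "\<bar>poincare a (of_int r) s pi - pi - 2 * pi * of_int r + a * J\<bar> < a * \<bar>J\<bar>"
    using poincare_small_a_bessel[of a r s] a unfolding J_def by auto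
  moreover have "snd (snd (axis_point r s a)) > 0" using a by (simp add: axis_point_def)
  ultimately show "axis_point r s a \<in> Z"
    using a assms(1) by (cases "J > 0")
      (simp_all add: Z_def upper_zone_def lower_zone_def josephson_poincare_axis_point J_def[symmetric] abs_less_iff)
qed

section \<open>Projection to the half-plane and crossing arcs\<close>

definition param_proj :: "real \<times> real \<times> real \<Rightarrow> real ^ 2" where
  "param_proj = (\<lambda>(B, A, \<omega>). vector [A / \<omega>, 1 / \<omega>])"

lemma param_proj_axis_point: "a > 0 \<Longrightarrow> param_proj (axis_point r s a) = vector [s, a]"
  by (simp add: param_proj_def axis_point_def)

lemma continuous_on_param_proj: "continuous_on {p. snd (snd p) > 0} param_proj"
proof -
  have "continuous_on {p. snd (snd p) > 0} (\<lambda>p. param_proj p $ i)" for i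
  proof -
    have "continuous_on {p :: real \<times> real \<times> real. snd (snd p) > 0} (\<lambda>p. fst (snd p) / snd (snd p))"
      "continuous_on {p :: real \<times> real \<times> real. snd (snd p) > 0} (\<lambda>p. 1 / snd (snd p))"
      by (auto intro!: continuous_intros)
    then show ?thesis using exhaust_2[of i] by (auto simp: param_proj_def split_beta)
  qed
  then have "continuous_on {p. snd (snd p) > 0} (\<lambda>p. \<chi> i. param_proj p $ i)"
    by (rule continuous_on_vec_lambda)
  then show ?thesis by simp
qed

text \<open>Points with the same projection differ only in \<open>B\<close>. The upper one needs the
  larger image of \<open>0\<close> and the lower one the larger image of \<open>pi\<close>, but both
  images increase with \<open>B\<close>.\<close>

lemma zones_param_proj_disjoint:
  assumes "p \<in> upper_zone r" "q \<in> lower_zone r"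
  shows "param_proj p \<noteq> param_proj q"
proof
  assume eq: "param_proj p = param_proj q"
  obtain B A \<omega> B' A' \<omega>' where pq: "p = (B, A, \<omega>)" "q = (B', A', \<omega>')"
    by (cases p, cases q) auto
  have \<omega>: "\<omega> > 0" "\<omega>' > 0" using assms by (auto simp: pq upper_zone_def lower_zone_def)
  have "1 / \<omega> = 1 / \<omega>'" "A / \<omega> = A' / \<omega>'"
    using arg_cong[OF eq, of "\<lambda>v. v $ 2"] arg_cong[OF eq, of "\<lambda>v. v $ 1"] by (simp_all add: pq param_proj_def)
  with \<omega> have same: "\<omega>' = \<omega>" "A' = A" by auto
  have z: "josephson_poincare 0 (B', A, \<omega>) < josephson_poincare 0 (B, A, \<omega>)"
    "josephson_poincare pi (B, A, \<omega>) < josephson_poincare pi (B', A, \<omega>)"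
    using assms by (auto simp: pq same upper_zone_def lower_zone_def)
  show False
    using josephson_poincare_strict_mono[OF _ \<omega>(1), of B B' 0 A] josephson_poincare_strict_mono[OF _ \<omega>(1), of B' B pi A] z
    by (cases B B' rule: linorder_cases) auto
qed

text \<open>A path inside \<open>C\<close> is projected and extended by vertical segments down to
  the line \<open>a = 0\<close>. The segments are only asked to lie over \<open>Z\<close>, which is
  enough for separating the two zones.\<close>

lemma zone_arc:
  assumes C: "open C" "connected C" "C \<subseteq> Z" and Z: "Z \<subseteq> {p. snd (snd p) > 0}"
    and s: "a > 0" "axis_point r s a \<in> C" "\<And>b. 0 < b \<Longrightarrow> b \<le> a \<Longrightarrow> axis_point r s b \<in> Z"
    and s': "a' > 0" "axis_point r s' a' \<in> C" "\<And>b. 0 < b \<Longrightarrow> b \<le> a' \<Longrightarrow> axis_point r s' b \<in> Z"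
  obtains g where "path g" "pathstart g = vector [s, 0]" "pathfinish g = vector [s', 0]"
    "path_image g \<subseteq> param_proj ` Z \<union> {vector [s, 0], vector [s', 0]}"
proof -
  have "path_connected C" using C(1,2) by (simp add: connected_open_path_connected)
  then obtain h where h: "path h" "path_image h \<subseteq> C" "pathstart h = axis_point r s a" "pathfinish h = axis_point r s' a'"
    using s(2) s'(2) unfolding path_connected_def by blast
  have ph: "path (param_proj \<circ> h)"
    using h(1,2) C(3) Z by (intro path_continuous_image continuous_on_subset[OF continuous_on_param_proj]) auto
  have ends: "pathstart (param_proj \<circ> h) = vector [s, a]" "pathfinish (param_proj \<circ> h) = vector [s', a']"
    using h(3,4) s(1) s'(1) by (simp_all add: pathstart_compose pathfinish_compose param_proj_axis_point)
  have vert: "closed_segment (vector [u, 0]) (vector [u, b]) \<subseteq> param_proj ` Z \<union> {vector [u, 0] :: real ^ 2}"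
    if "b > 0" "\<And>c. 0 < c \<Longrightarrow> c \<le> b \<Longrightarrow> axis_point r u c \<in> Z" for u b
  proof
    fix z :: "real ^ 2" assume "z \<in> closed_segment (vector [u, 0]) (vector [u, b])"
    then obtain k where k: "0 \<le> k" "k \<le> 1" "z = (1 - k) *\<^sub>R vector [u, 0] + k *\<^sub>R vector [u, b]"
      by (auto simp: in_segment)
    have z: "z = vector [u, k * b]"
      unfolding k(3) by (simp add: vec_eq_iff forall_2 algebra_simps)
    show "z \<in> param_proj ` Z \<union> {vector [u, 0]}"
    proof (cases "k = 0")
      case False
      then have "0 < k * b" "k * b \<le> b" using k that(1) by (auto simp: mult_left_le_one_le)
      then show ?thesis
        using that(2)[of "k * b"] z param_proj_axis_point[of "k * b" r u] by (auto intro!: image_eqI[of _ _ "axis_point r u (k * b)"])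
    qed (use z in simp)
  qed
  define g where "g = linepath (vector [s, 0]) (vector [s, a]) +++ (param_proj \<circ> h) +++ linepath (vector [s', a']) (vector [s', 0])"
  have "path_image (param_proj \<circ> h) \<subseteq> param_proj ` Z"
    using h(2) C(3) by (auto simp: path_image_compose)
  moreover have "path_image g = closed_segment (vector [s, 0]) (vector [s, a]) \<union> (path_image (param_proj \<circ> h)
      \<union> closed_segment (vector [s', 0]) (vector [s', a']))"
    unfolding g_def using ends by (simp add: path_image_join closed_segment_commute)
  ultimately have "path_image g \<subseteq> param_proj ` Z \<union> {vector [s, 0], vector [s', 0]}"
    using vert[OF s(1,3)] vert[OF s'(1,3)] by auto
  moreover have "path g" "pathstart g = vector [s, 0]" "pathfinish g = vector [s', 0]"
    unfolding g_def using ph ends by simp_all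
  ultimately show ?thesis using that by blast
qed

text \<open>In a box with all four endpoints interlaced on its bottom edge the arcs must cross. The
  crossing cannot have \<open>a > 0\<close>, as the projected zones are disjoint, nor
  \<open>a = 0\<close>, where the arcs have only their distinct endpoints.\<close>

lemma zone_arcs_interlaced:
  fixes f g :: "real \<Rightarrow> real ^ 2"
  assumes f: "path f" "pathstart f = vector [s1, 0]" "pathfinish f = vector [s3, 0]"
      "path_image f \<subseteq> param_proj ` upper_zone r \<union> {vector [s1, 0], vector [s3, 0]}"
    and g: "path g" "pathstart g = vector [s2, 0]" "pathfinish g = vector [s4, 0]"
      "path_image g \<subseteq> param_proj ` lower_zone r \<union> {vector [s2, 0], vector [s4, 0]}"
    and less: "s1 < s2" "s2 < s3" "s3 < s4"
  shows False
proof -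
  have pos: "param_proj p $ 2 > 0" if "p \<in> upper_zone r \<union> lower_zone r" for p
    using that by (auto simp: param_proj_def upper_zone_def lower_zone_def split_beta)
  have "bounded (path_image f \<union> path_image g)"
    using f(1) g(1) by (simp add: bounded_path_image)
  then obtain M where M: "\<And>z. z \<in> path_image f \<union> path_image g \<Longrightarrow> norm z \<le> M"
    by (auto simp: bounded_iff)
  have box: "z \<in> cbox (vector [- M, 0]) (vector [M, M])" if z: "z \<in> path_image f \<union> path_image g" for z
  proof -
    have "\<bar>z $ i\<bar> \<le> M" for i using M[OF z] component_le_norm_cart[of z i] by linarith
    moreover have "z \<in> param_proj ` (upper_zone r \<union> lower_zone r)
        \<union> {vector [s1, 0], vector [s3, 0], vector [s2, 0], vector [s4, 0]}"
      using z f(4) g(4) by blast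
    then have "z $ 2 \<ge> 0" using pos by (auto intro: less_imp_le)
    ultimately show ?thesis by (auto simp: mem_box_cart forall_2 abs_le_iff minus_le_iff)
  qed
  obtain z where z: "z \<in> path_image f" "z \<in> path_image g"
    by (rule fashoda_interlace[OF f(1) g(1), of "vector [- M, 0]" "vector [M, M]"])
      (use box less in \<open>auto simp: f g\<close>)
  have "z $ 2 = 0 \<or> z \<in> param_proj ` upper_zone r" "z $ 2 = 0 \<or> z \<in> param_proj ` lower_zone r"
    using z f(4) g(4) by auto
  then have "z $ 2 = 0" using zones_param_proj_disjoint by (metis imageE)
  then have "z \<notin> param_proj ` upper_zone r" "z \<notin> param_proj ` lower_zone r"
    using pos by fastforce+
  with z f(4) g(4) have "z \<in> {vector [s1, 0], vector [s3, 0]}" "z \<in> {vector [s2, 0], vector [s4, 0]}" by blast+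
  then have "z $ 1 \<in> {s1, s3}" "z $ 1 \<in> {s2, s4}" by (metis insert_iff singletonD vector_2(1))+
  with less show False by auto
qed

text \<open>A finite union of sets bounded above is bounded above, so one component must receive
  arbitrarily large \<open>s\<close>.\<close>

lemma component_with_unbounded_axis_points:
  assumes fin: "finite (components S)" and Z: "Z \<subseteq> S"
    and unb: "\<And>c. \<exists>s>c. \<exists>a>0. \<forall>b. 0 < b \<and> b \<le> a \<longrightarrow> axis_point r s b \<in> Z"
  obtains C where "C \<in> components S"
    "\<And>c. \<exists>s>c. \<exists>a>0. axis_point r s a \<in> C \<and> (\<forall>b. 0 < b \<and> b \<le> a \<longrightarrow> axis_point r s b \<in> Z)"
proof -
  define T where "T C = {s. \<exists>a>0. axis_point r s a \<in> C \<and> (\<forall>b. 0 < b \<and> b \<le> a \<longrightarrow> axis_point r s b \<in> Z)}" for C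
  have "\<not> bdd_above (\<Union>C\<in>components S. T C)"
  proof
    assume "bdd_above (\<Union>C\<in>components S. T C)"
    then obtain c where c: "\<And>s. s \<in> (\<Union>C\<in>components S. T C) \<Longrightarrow> s \<le> c" by (auto simp: bdd_above_def)
    obtain s a where s: "s > c" "a > 0" "\<forall>b. 0 < b \<and> b \<le> a \<longrightarrow> axis_point r s b \<in> Z" using unb by blast
    then have "axis_point r s a \<in> \<Union> (components S)" using Z by auto
    then obtain C where "C \<in> components S" "axis_point r s a \<in> C" by blast
    with s have "s \<in> (\<Union>C\<in>components S. T C)" by (auto simp: T_def)
    with c s(1) show False by force
  qed
  then have "\<exists>C\<in>components S. \<not> bdd_above (T C)"
    by (simp add: fin)
  then obtain C where C: "C \<in> components S" "\<not> bdd_above (T C)" ..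
  then have "\<exists>s>c. s \<in> T C" for c unfolding bdd_above_def by (meson not_le)
  with C(1) that[of C] show ?thesis unfolding T_def by blast
qed

theorem theorem1p5:
  fixes r :: int
  shows "infinite (components (interior (phase_lock_area (of_int r))))"
proof
  define S where "S = interior (phase_lock_area (of_int r))"
  have S: "S = upper_zone r \<union> lower_zone r" by (simp add: S_def interior_phase_lock_area)
  assume "finite (components (interior (phase_lock_area (of_int r))))"
  then have fin: "finite (components S)" by (simp add: S_def)
  have "\<exists>s>c. \<exists>a>0. \<forall>b. 0 < b \<and> b \<le> a \<longrightarrow> axis_point r s b \<in> upper_zone r" for c
  proof -
    obtain s where "s > c" "bessel_integral r s > 0"
      using oscillates_bessel_integral[of r] unfolding oscillates_def by blast
    with axis_point_in_zone[of r s] show ?thesis by auto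
  qed
  from component_with_unbounded_axis_points[OF fin _ this] S
  obtain C where C: "C \<in> components S"
    "\<And>c. \<exists>s>c. \<exists>a>0. axis_point r s a \<in> C \<and> (\<forall>b. 0 < b \<and> b \<le> a \<longrightarrow> axis_point r s b \<in> upper_zone r)"
    by auto
  have "\<exists>s>c. \<exists>a>0. \<forall>b. 0 < b \<and> b \<le> a \<longrightarrow> axis_point r s b \<in> lower_zone r" for c
  proof -
    obtain s where "s > c" "bessel_integral r s < 0"
      using oscillates_bessel_integral[of r] unfolding oscillates_def by blast
    with axis_point_in_zone[of r s] show ?thesis by auto
  qed
  from component_with_unbounded_axis_points[OF fin _ this] S
  obtain D where D: "D \<in> components S"
    "\<And>c. \<exists>s>c. \<exists>a>0. axis_point r s a \<in> D \<and> (\<forall>b. 0 < b \<and> b \<le> a \<longrightarrow> axis_point r s b \<in> lower_zone r)"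
    by auto
  have "open S" by (simp add: S_def)
  then have open_CD: "open C" "open D" using C(1) D(1) open_components by blast+
  have conn: "connected C" "connected D" using C(1) D(1) in_components_connected by blast+
  have disj: "upper_zone r \<inter> lower_zone r = {}" by (auto simp: upper_zone_def lower_zone_def)
  \<comment> \<open>The zones are disjoint open sets covering \<open>S\<close>, so a connected
    subset lies in one of them.\<close>
  have split: "E \<subseteq> upper_zone r \<or> E \<subseteq> lower_zone r" if "E \<in> components S" for E
    using connectedD[OF in_components_connected[OF that] open_zones(1)[of r] open_zones(2)[of r]]
      in_components_subset[OF that] disj unfolding S by blast
  have "C \<inter> upper_zone r \<noteq> {}" "D \<inter> lower_zone r \<noteq> {}" using C(2)[of 0] D(2)[of 0] by blast+
  with split[OF C(1)] split[OF D(1)] disj have sub: "C \<subseteq> upper_zone r" "D \<subseteq> lower_zone r" by blast+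
  have pos: "upper_zone r \<subseteq> {p. snd (snd p) > 0}" "lower_zone r \<subseteq> {p. snd (snd p) > 0}"
    by (auto simp: upper_zone_def lower_zone_def)
  \<comment> \<open>The four abscissae are taken alternately from \<open>C\<close> and
    \<open>D\<close>, each beyond the previous one.\<close>
  obtain s1 a1 where 1: "a1 > 0" "axis_point r s1 a1 \<in> C" "\<And>b. 0 < b \<Longrightarrow> b \<le> a1 \<Longrightarrow> axis_point r s1 b \<in> upper_zone r"
    using C(2)[of 0] by blast
  obtain s2 a2 where 2: "s1 < s2" "a2 > 0" "axis_point r s2 a2 \<in> D" "\<And>b. 0 < b \<Longrightarrow> b \<le> a2 \<Longrightarrow> axis_point r s2 b \<in> lower_zone r"
    using D(2)[of s1] by blast
  obtain s3 a3 where 3: "s2 < s3" "a3 > 0" "axis_point r s3 a3 \<in> C" "\<And>b. 0 < b \<Longrightarrow> b \<le> a3 \<Longrightarrow> axis_point r s3 b \<in> upper_zone r"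
    using C(2)[of s2] by blast
  obtain s4 a4 where 4: "s3 < s4" "a4 > 0" "axis_point r s4 a4 \<in> D" "\<And>b. 0 < b \<Longrightarrow> b \<le> a4 \<Longrightarrow> axis_point r s4 b \<in> lower_zone r"
    using D(2)[of s3] by blast
  obtain f where f: "path f" "pathstart f = vector [s1, 0]" "pathfinish f = vector [s3, 0]"
    "path_image f \<subseteq> param_proj ` upper_zone r \<union> {vector [s1, 0], vector [s3, 0]}"
    by (rule zone_arc[OF open_CD(1) conn(1) sub(1) pos(1) 1 3(2-)])
  obtain g where g: "path g" "pathstart g = vector [s2, 0]" "pathfinish g = vector [s4, 0]"
    "path_image g \<subseteq> param_proj ` lower_zone r \<union> {vector [s2, 0], vector [s4, 0]}"
    by (rule zone_arc[OF open_CD(2) conn(2) sub(2) pos(2) 2(2-) 4(2-)])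
  show False by (rule zone_arcs_interlaced[OF f g 2(1) 3(1) 4(1)])
qed

end
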